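(* Let $\Sigma=(-A,B,C)$ be a $(2,2)$-admissible linear system with input and output space $H_0=\mathbf{C}$ such that $\|e^{-t_0A}\|<1$ for some $t_0>0$, $B$ and $C$ are Hilbert--Schmidt with $\|B\|_{\mathcal{L}^2}\|C\|_{\mathcal{L}^2}\le1$, and $-A$ is sectorial on $S_\theta$ for some $\pi/2<\theta<\pi$. Let $\lfloor\,\cdot\,\rfloor$ be the bracket $\lfloor P\rfloor=Ce^{-xA}F_xPF_xe^{-xA}B$ on $\mathcal{A}_\Sigma$. Then $f_m=(-1)^m2\lfloor A^{2m-1}\rfloor$ $(m\ge1)$ satisfies the stationary KdV hierarchy (Novikov's equations) $$4\frac{df_{m+1}}{dx}=4f_1\frac{df_m}{dx}+4\frac{d}{dx}\big(f_1f_m\big)-\frac{d^3f_m}{dx^3},$$ since for $m\ge0$ $$4\frac{d}{dx}\lfloor A^{2m+3}\rfloor=\frac{d^3}{dx^3}\lfloor A^{2m+1}\rfloor+8\Big(\frac{d}{dx}\lfloor A\rfloor\Big)\lfloor A^{2m+1}\rfloor+16\lfloor A\rfloor\Big(\frac{d}{dx}\lfloor A^{2m+1}\rfloor\Big).$$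
   Context: In a linear system $(-A,B,C)$, $-A$ generates a bounded strongly continuous semigroup $(e^{-tA})_{t\ge0}$ on the complex separable Hilbert space $H$, and $B:H_0\to H$, $C:H\to H_0$ are bounded. It is $(2,2)$-admissible if $\Theta_0f=\int_0^\infty e^{-sA^\dagger}C^\dagger f(s)\,ds$ and $\Xi_0f=\int_0^\infty e^{-sA}Bf(s)\,ds$ define Hilbert--Schmidt operators $L^2((0,\infty);H_0)\to H$. $R_x=\int_x^\infty e^{-tA}BCe^{-tA}\,dt$, $F_x=(I+R_x)^{-1}$, and $x$ ranges over a sector containing some $(x_1,\infty)$ on which these are defined and holomorphic. $\mathcal{A}_\Sigma$ is the complex span of the powers of $A$ and the words $A^{n_1}F_xA^{n_2}\cdots F_xA^{n_r}$. $S_\theta=\{z\ne0:|\arg z|<\theta\}$; $-A$ is sectorial on $S_\theta$ if $S_\theta$ lies in the resolvent set of $-A$ and $|\lambda|\|(\lambda I+A)^{-1}\|$ is bounded there. The potential is $u=-2\frac{d^2}{dx^2}\log\det(I+R_x)=-4\lfloor A\rfloor$, so $f_1=\frac12u$. *)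

theory Defs
  imports "HOL-Analysis.Analysis"
begin

section \<open>Complex Hilbert spaces\<close>

text \<open>The norm is the one of \<open>real_inner\<close>, so by \<open>inner_eq_Re_cinner\<close> it is the Hilbert space
  norm of \<open>cinner\<close>. The inner product is conjugate linear in its first argument. Separability is
  expressed by adding the sort \<open>second_countable_topology\<close>.\<close>

class complex_hilbert = real_inner + complete_space +
  fixes scaleC :: "complex \<Rightarrow> 'a \<Rightarrow> 'a" (infixr "*\<^sub>C" 75)
    and cinner :: "'a \<Rightarrow> 'a \<Rightarrow> complex"
  assumes scaleC_add_right: "c *\<^sub>C (x + y) = c *\<^sub>C x + c *\<^sub>C y"
    and scaleC_add_left: "(c + d) *\<^sub>C x = c *\<^sub>C x + d *\<^sub>C x"
    and scaleC_scaleC: "c *\<^sub>C d *\<^sub>C x = (c * d) *\<^sub>C x"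
    and scaleC_of_real: "complex_of_real r *\<^sub>C x = r *\<^sub>R x"
    and cinner_commute: "cinner x y = cnj (cinner y x)"
    and cinner_add_right: "cinner x (y + z) = cinner x y + cinner x z"
    and cinner_scaleC_right: "cinner x (c *\<^sub>C y) = c * cinner x y"
    and inner_eq_Re_cinner: "inner x y = Re (cinner x y)"

instantiation complex :: complex_hilbert
begin

definition scaleC_complex :: "complex \<Rightarrow> complex \<Rightarrow> complex" where
  "scaleC_complex c x = c * x"

definition cinner_complex :: "complex \<Rightarrow> complex \<Rightarrow> complex" where
  "cinner_complex x y = cnj x * y"

instance
  by standard
    (auto simp: scaleC_complex_def cinner_complex_def algebra_simps scaleR_conv_of_real inner_complex_def)

end

definition bounded_clinear :: "('a::complex_hilbert \<Rightarrow> 'b::complex_hilbert) \<Rightarrow> bool" where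
  "bounded_clinear f \<longleftrightarrow> bounded_linear f \<and> (\<forall>c v. f (c *\<^sub>C v) = c *\<^sub>C f v)"

definition cadjoint :: "('a::complex_hilbert \<Rightarrow> 'b::complex_hilbert) \<Rightarrow> 'b \<Rightarrow> 'a" where
  "cadjoint f = (SOME g. \<forall>x y. cinner (f x) y = cinner x (g y))"

text \<open>Holomorphy of a family of bounded operators with respect to the operator norm.\<close>

definition op_holomorphic_on ::
  "(complex \<Rightarrow> 'a::complex_hilbert \<Rightarrow> 'b::complex_hilbert) \<Rightarrow> complex set \<Rightarrow> bool" where
  "op_holomorphic_on G \<Omega> \<longleftrightarrow>
     (\<forall>z\<in>\<Omega>. bounded_clinear (G z)) \<and>
     (\<forall>z\<in>\<Omega>. \<exists>G'. bounded_clinear G' \<and>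
        ((\<lambda>h. onorm (\<lambda>v. inverse h *\<^sub>C (G (z + h) v - G z v) - G' v)) \<longlongrightarrow> 0) (at 0))"


section \<open>Hilbert--Schmidt operators\<close>

text \<open>\<open>orthonormal_basis V ip S\<close>: \<open>S\<close> is a maximal orthonormal subset of the (semi-)inner product
  space \<open>V\<close>. The carrier \<open>V\<close> makes this usable both for types of class \<open>complex_hilbert\<close> and for
  $L^2$, whose elements are represented by functions that need not be identified almost
  everywhere.\<close>

definition orthonormal_basis :: "'f set \<Rightarrow> ('f \<Rightarrow> 'f \<Rightarrow> complex) \<Rightarrow> 'f set \<Rightarrow> bool" where
  "orthonormal_basis V ip S \<longleftrightarrow>
     S \<subseteq> V \<and> (\<forall>e\<in>S. \<forall>e'\<in>S. ip e e' = (if e = e' then 1 else 0)) \<and>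
     (\<forall>f\<in>V. (\<forall>e\<in>S. ip e f = 0) \<longrightarrow> ip f f = 0)"

definition hilbert_schmidt :: "('a::complex_hilbert \<Rightarrow> 'b::complex_hilbert) \<Rightarrow> bool" where
  "hilbert_schmidt f \<longleftrightarrow> bounded_clinear f \<and>
     (\<exists>S. orthonormal_basis UNIV cinner S \<and> (\<lambda>e. (norm (f e))\<^sup>2) summable_on S)"

text \<open>The value does not depend on the basis that is chosen.\<close>

definition hs_norm :: "('a::complex_hilbert \<Rightarrow> 'b::complex_hilbert) \<Rightarrow> real" where
  "hs_norm f = sqrt (\<Sum>\<^sub>\<infinity>e\<in>(SOME S. orthonormal_basis UNIV cinner S). (norm (f e))\<^sup>2)"

definition L2_half :: "(real \<Rightarrow> 'k::{complex_hilbert,second_countable_topology}) set" where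
  "L2_half = {f. set_borel_measurable lborel {0<..} f \<and>
                 set_integrable lborel {0<..} (\<lambda>s. (norm (f s))\<^sup>2)}"

definition L2_inner ::
  "(real \<Rightarrow> 'k::{complex_hilbert,second_countable_topology}) \<Rightarrow> (real \<Rightarrow> 'k) \<Rightarrow> complex" where
  "L2_inner f g = (LINT s:{0<..}|lborel. cinner (f s) (g s))"

definition hilbert_schmidt_L2 ::
  "((real \<Rightarrow> 'k::{complex_hilbert,second_countable_topology}) \<Rightarrow> 'h::complex_hilbert) \<Rightarrow> bool" where
  "hilbert_schmidt_L2 \<Phi> \<longleftrightarrow>
     (\<forall>f\<in>L2_half. \<forall>g\<in>L2_half. \<Phi> (\<lambda>s. f s + g s) = \<Phi> f + \<Phi> g) \<and>
     (\<forall>c. \<forall>f\<in>L2_half. \<Phi> (\<lambda>s. c *\<^sub>C f s) = c *\<^sub>C \<Phi> f) \<and>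
     (\<exists>K. \<forall>f\<in>L2_half. norm (\<Phi> f) \<le> K * sqrt (Re (L2_inner f f))) \<and>
     (\<exists>S. orthonormal_basis L2_half L2_inner S \<and> (\<lambda>e. (norm (\<Phi> e))\<^sup>2) summable_on S)"


section \<open>Semigroups, generators and sectorial operators\<close>

definition bounded_c0_semigroup :: "(real \<Rightarrow> 'h::complex_hilbert \<Rightarrow> 'h) \<Rightarrow> bool" where
  "bounded_c0_semigroup T \<longleftrightarrow>
     (\<forall>t\<ge>0. bounded_clinear (T t)) \<and> T 0 = id \<and>
     (\<forall>s\<ge>0. \<forall>t\<ge>0. T (s + t) = T s \<circ> T t) \<and>
     (\<forall>v. continuous_on {0..} (\<lambda>t. T t v)) \<and>
     (\<exists>M. \<forall>t\<ge>0. onorm (T t) \<le> M)"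

text \<open>An unbounded operator is a total function \<open>L\<close> together with its domain \<open>D\<close>; the values of \<open>L\<close>
  outside \<open>D\<close> are arbitrary.\<close>

definition generates :: "'h::complex_hilbert set \<Rightarrow> ('h \<Rightarrow> 'h) \<Rightarrow> (real \<Rightarrow> 'h \<Rightarrow> 'h) \<Rightarrow> bool" where
  "generates D L T \<longleftrightarrow>
     D = {v. \<exists>w. ((\<lambda>t. (T t v - v) /\<^sub>R t) \<longlongrightarrow> w) (at_right 0)} \<and>
     (\<forall>v\<in>D. ((\<lambda>t. (T t v - v) /\<^sub>R t) \<longlongrightarrow> L v) (at_right 0))"

definition pow_dom :: "'h set \<Rightarrow> ('h \<Rightarrow> 'h) \<Rightarrow> nat \<Rightarrow> 'h set" where
  "pow_dom D A k = {v. \<forall>j<k. (A ^^ j) v \<in> D}"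

definition resolvent :: "'h::complex_hilbert set \<Rightarrow> ('h \<Rightarrow> 'h) \<Rightarrow> complex \<Rightarrow> 'h \<Rightarrow> 'h" where
  "resolvent D L \<mu> = inv_into D (\<lambda>v. \<mu> *\<^sub>C v - L v)"

definition resolvent_set :: "'h::complex_hilbert set \<Rightarrow> ('h \<Rightarrow> 'h) \<Rightarrow> complex set" where
  "resolvent_set D L =
     {\<mu>. bij_betw (\<lambda>v. \<mu> *\<^sub>C v - L v) D UNIV \<and> bounded_clinear (resolvent D L \<mu>)}"

definition sector :: "real \<Rightarrow> complex set" where
  "sector \<theta> = {z. z \<noteq> 0 \<and> \<bar>Arg z\<bar> < \<theta>}"

definition sectorial_on :: "'h::complex_hilbert set \<Rightarrow> ('h \<Rightarrow> 'h) \<Rightarrow> real \<Rightarrow> bool" where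
  "sectorial_on D L \<theta> \<longleftrightarrow>
     sector \<theta> \<subseteq> resolvent_set D L \<and>
     (\<exists>K. \<forall>\<mu>\<in>sector \<theta>. cmod \<mu> * onorm (resolvent D L \<mu>) \<le> K)"


section \<open>Linear systems\<close>

text \<open>The linear system $(-A,B,C)$, with \<open>D\<close> the domain of \<open>A\<close> and \<open>T t\<close> standing for $e^{-tA}$,
  $t \ge 0$.\<close>

definition linear_system ::
  "'h::{complex_hilbert,second_countable_topology} set \<Rightarrow> ('h \<Rightarrow> 'h) \<Rightarrow> (real \<Rightarrow> 'h \<Rightarrow> 'h) \<Rightarrow>
   ('k::{complex_hilbert,second_countable_topology} \<Rightarrow> 'h) \<Rightarrow> ('h \<Rightarrow> 'k) \<Rightarrow> bool" where
  "linear_system D A T B C \<longleftrightarrow>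
     bounded_c0_semigroup T \<and> generates D (\<lambda>v. - A v) T \<and> bounded_clinear B \<and> bounded_clinear C"

text \<open>Here $e^{-sA^\dagger}$ is the adjoint of $e^{-sA}$.\<close>

definition admissible22 ::
  "(real \<Rightarrow> 'h \<Rightarrow> 'h::{complex_hilbert,second_countable_topology}) \<Rightarrow>
   ('k::{complex_hilbert,second_countable_topology} \<Rightarrow> 'h) \<Rightarrow> ('h \<Rightarrow> 'k) \<Rightarrow> bool" where
  "admissible22 T B C \<longleftrightarrow>
     (\<forall>f\<in>L2_half. set_integrable lborel {0<..} (\<lambda>s. cadjoint (T s) (cadjoint C (f s)))) \<and>
     hilbert_schmidt_L2 (\<lambda>f. LINT s:{0<..}|lborel. cadjoint (T s) (cadjoint C (f s))) \<and>
     (\<forall>f\<in>L2_half. set_integrable lborel {0<..} (\<lambda>s. T s (B (f s)))) \<and>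
     hilbert_schmidt_L2 (\<lambda>f. LINT s:{0<..}|lborel. T s (B (f s)))"

text \<open>Below, \<open>E z\<close> stands for $e^{-zA}$ with complex \<open>z\<close>. The integral from \<open>z\<close> to infinity in
  $R_z$ is taken along the horizontal ray \<open>z + s\<close>, \<open>s \<ge> 0\<close>, and pointwise (in the strong sense).\<close>

definition sys_R ::
  "(complex \<Rightarrow> 'h \<Rightarrow> 'h::{complex_hilbert,second_countable_topology}) \<Rightarrow> ('k \<Rightarrow> 'h) \<Rightarrow> ('h \<Rightarrow> 'k) \<Rightarrow>
   complex \<Rightarrow> 'h \<Rightarrow> 'h" where
  "sys_R E B C z v =
     (LINT s:{0..}|lborel. E (z + complex_of_real s) (B (C (E (z + complex_of_real s) v))))"

definition sys_F ::
  "(complex \<Rightarrow> 'h \<Rightarrow> 'h::{complex_hilbert,second_countable_topology}) \<Rightarrow> ('k \<Rightarrow> 'h) \<Rightarrow> ('h \<Rightarrow> 'k) \<Rightarrow>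
   complex \<Rightarrow> 'h \<Rightarrow> 'h" where
  "sys_F E B C z = inv (\<lambda>v. v + sys_R E B C z v)"

text \<open>\<open>E\<close> is a holomorphic continuation of the semigroup \<open>T\<close> to \<open>\<Omega>\<close>, and $R_z$ and
  $F_z = (I + R_z)^{-1}$ are defined and holomorphic there.\<close>

definition holomorphic_system_on ::
  "(real \<Rightarrow> 'h \<Rightarrow> 'h::{complex_hilbert,second_countable_topology}) \<Rightarrow>
   ('k::complex_hilbert \<Rightarrow> 'h) \<Rightarrow> ('h \<Rightarrow> 'k) \<Rightarrow> (complex \<Rightarrow> 'h \<Rightarrow> 'h) \<Rightarrow> complex set \<Rightarrow> bool" where
  "holomorphic_system_on T B C E \<Omega> \<longleftrightarrow>
     op_holomorphic_on E \<Omega> \<and>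
     (\<forall>t\<ge>0. complex_of_real t \<in> \<Omega> \<longrightarrow> E (complex_of_real t) = T t) \<and>
     (\<forall>z\<in>\<Omega>. \<forall>v. set_integrable lborel {0..}
        (\<lambda>s. E (z + complex_of_real s) (B (C (E (z + complex_of_real s) v))))) \<and>
     op_holomorphic_on (sys_R E B C) \<Omega> \<and>
     (\<forall>z\<in>\<Omega>. bij (\<lambda>v. v + sys_R E B C z v)) \<and>
     op_holomorphic_on (sys_F E B C) \<Omega>"


section \<open>The algebra and the bracket\<close>

text \<open>The elements of the algebra are functions of the variable \<open>x\<close> (through $F_x$) with
  operators as values.\<close>

inductive_set words :: "('h \<Rightarrow> 'h) \<Rightarrow> (complex \<Rightarrow> 'h \<Rightarrow> 'h) \<Rightarrow> (complex \<Rightarrow> 'h \<Rightarrow> 'h) set"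
  for A F where
    power: "(\<lambda>x. A ^^ n) \<in> words A F"
  | Cons: "P \<in> words A F \<Longrightarrow> (\<lambda>x. (A ^^ n) \<circ> F x \<circ> P x) \<in> words A F"

inductive_set alg_Sigma ::
  "('h::complex_hilbert \<Rightarrow> 'h) \<Rightarrow> (complex \<Rightarrow> 'h \<Rightarrow> 'h) \<Rightarrow> (complex \<Rightarrow> 'h \<Rightarrow> 'h) set"
  for A F where
    word: "P \<in> words A F \<Longrightarrow> P \<in> alg_Sigma A F"
  | add: "P \<in> alg_Sigma A F \<Longrightarrow> Q \<in> alg_Sigma A F \<Longrightarrow> (\<lambda>x v. P x v + Q x v) \<in> alg_Sigma A F"
  | scale: "P \<in> alg_Sigma A F \<Longrightarrow> (\<lambda>x v. c *\<^sub>C P x v) \<in> alg_Sigma A F"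

text \<open>For input and output space \<open>\<complex>\<close>, an operator \<open>\<complex> \<rightarrow> \<complex>\<close> is identified with its value at 1.\<close>

definition bracket ::
  "('h::{complex_hilbert,second_countable_topology} \<Rightarrow> 'h) \<Rightarrow> (complex \<Rightarrow> 'h) \<Rightarrow> ('h \<Rightarrow> complex) \<Rightarrow>
   (complex \<Rightarrow> 'h \<Rightarrow> 'h) \<Rightarrow> (complex \<Rightarrow> 'h \<Rightarrow> 'h) \<Rightarrow> complex \<Rightarrow> complex" where
  "bracket A B C E =
     (\<lambda>P \<in> alg_Sigma A (sys_F E B C).
        \<lambda>x. C (E x (sys_F E B C x (P x (sys_F E B C x (E x (B 1)))))))"

end

theory Submission
  imports Defs "HOL-Complex_Analysis.Complex_Analysis"
begin

text \<open>The recursion is an identity in an algebra of operators, once enough regularity is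
  available to write it down. Put \<open>E\<close> for $e^{-xA}$, $b = B1$, $w = FEb$ and
  $\ell(v) = CEFv$, so that $\lfloor P\rfloor = \ell(Pw)$, and let $J = I - 2F$.

  Differentiating $R_x$ in two ways gives $R' = -(Eb)(CE)$ and the Lyapunov equation
  $AR + RA = (Eb)(CE)$. Adding $2A$ to the latter and
  multiplying by $F = (I+R)^{-1}$ on both sides yields
  $AF + FA = 2FAF + w\ell$ (lemma \<open>commutator\<close>), that is $JAJ = A - 2w\ell$ (lemma \<open>J_A_J\<close>): two
  factors $J$ around an $A$ can be traded for a product of brackets. The same equation turns the
  derivatives into $F' = w\ell$, $w' = JAw$ and $(\ell u)' = \ell(AJu) + \ell(u')$ (lemmas
  \<open>F_opderiv\<close>, \<open>smooth_wvec\<close>, \<open>lfun_smooth_deriv\<close>). With $h_k = \lfloor AJA^kJA\rfloor$, two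
  differentiations give
  $\lfloor A^k\rfloor'' = 2\lfloor A^{k+2}\rfloor - 8\lfloor A\rfloor\lfloor A^k\rfloor + 2h_k$,
  and one more gives $h_k' = \lfloor A^{k+2}\rfloor' - 4\lfloor A\rfloor\lfloor A^k\rfloor'$.
  Eliminating $h_k$ is the recursion, for every \<open>k\<close> of either parity; the odd \<open>k\<close> are the
  stationary KdV hierarchy.

  The analytic part has to make sense of words in the unbounded operator \<open>A\<close>. By the identity
  theorem the semigroup law $E(z+t) = E(z)T(t) = T(t)E(z)$ survives the continuation, and this
  shows that $A^jE(z)v = (-1)^jE^{(j)}(z)v$, so that the range of \<open>E z\<close> consists of smooth vectors
  of \<open>A\<close>; here one needs that the derivative of an operator-valued holomorphic function is again
  holomorphic (\<open>op_holomorphic_deriv\<close>), which follows from scalar Cauchy estimates that are uniform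
  over matrix coefficients. Since $\|T(t_0)\| < 1$, the semigroup decays exponentially, hence the
  Gramian $G = \int_0^\infty T(s)BCT(s)\,ds$ is a bounded operator and $R_z = E(z)GE(z)$
  (\<open>R_eq\<close>). Therefore $Fv = v - EGEFv$ differs from \<open>v\<close> by a vector in the range of \<open>E z\<close>. So
  \<open>F\<close> preserves the smooth vectors, and all powers of \<open>A\<close> can be applied to, and commute with
  differentiation of, every vector that occurs (\<open>smooth_F\<close>).\<close>

section \<open>Complex Hilbert spaces\<close>

text \<open>The class \<open>banach\<close> has no axioms beyond its two parents, but Bochner integrals ask for it
  by name.\<close>

instance complex_hilbert \<subseteq> banach ..

lemma cinner_scaleC_left:
  fixes x y :: "'a::complex_hilbert"
  shows "cinner (c *\<^sub>C x) y = cnj c * cinner x y"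
  by (metis cinner_commute cinner_scaleC_right complex_cnj_mult)

lemma cinner_self:
  fixes v :: "'a::complex_hilbert"
  shows "cinner v v = complex_of_real ((norm v)\<^sup>2)"
proof -
  have "Im (cinner v v) = 0"
    using arg_cong[OF cinner_commute[of v v], of Im] by simp
  moreover have "Re (cinner v v) = (norm v)\<^sup>2"
    by (simp add: power2_norm_eq_inner flip: inner_eq_Re_cinner)
  ultimately show ?thesis by (simp add: complex_eq_iff)
qed

lemma norm_scaleC [simp]:
  fixes v :: "'a::complex_hilbert"
  shows "norm (c *\<^sub>C v) = cmod c * norm v"
proof -
  have "complex_of_real ((norm (c *\<^sub>C v))\<^sup>2) = (c * cnj c) * complex_of_real ((norm v)\<^sup>2)"
    unfolding cinner_self[symmetric] by (simp add: cinner_scaleC_left cinner_scaleC_right)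
  also have "\<dots> = complex_of_real ((cmod c * norm v)\<^sup>2)"
    by (simp only: complex_norm_square[symmetric] power_mult_distrib of_real_mult of_real_power)
  finally have "(norm (c *\<^sub>C v))\<^sup>2 = (cmod c * norm v)\<^sup>2"
    using of_real_eq_iff by blast
  then show ?thesis by (rule power2_eq_imp_eq) auto
qed

text \<open>Multiplying \<open>y\<close> by a unimodular scalar makes \<open>cinner x y\<close> real and nonnegative, which
  reduces the claim to the real Cauchy--Schwarz inequality.\<close>

lemma norm_cinner_le:
  fixes x y :: "'a::complex_hilbert"
  shows "cmod (cinner x y) \<le> norm x * norm y"
proof (cases "cinner x y = 0")
  case False
  define c where "c = cnj (cinner x y) / cmod (cinner x y)"
  have c: "cmod c = 1" using False by (simp add: c_def norm_divide)
  have "cinner x (c *\<^sub>C y) = (cinner x y * cnj (cinner x y)) / cmod (cinner x y)"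
    by (simp add: cinner_scaleC_right c_def)
  also have "\<dots> = complex_of_real (cmod (cinner x y))"
    unfolding complex_norm_square[symmetric] using False by (simp add: power2_eq_square)
  finally have "cmod (cinner x y) = inner x (c *\<^sub>C y)"
    by (simp add: inner_eq_Re_cinner)
  also have "\<dots> \<le> norm x * norm (c *\<^sub>C y)"
    by (rule norm_cauchy_schwarz)
  finally show ?thesis by (simp add: c)
qed simp

lemma bounded_bilinear_scaleC:
  "bounded_bilinear (scaleC :: complex \<Rightarrow> 'a::complex_hilbert \<Rightarrow> 'a)"
proof
  fix r :: real and c :: complex and v :: 'a
  show "(r *\<^sub>R c) *\<^sub>C v = r *\<^sub>R (c *\<^sub>C v)"
    by (simp add: scaleR_conv_of_real scaleC_of_real flip: scaleC_scaleC)
  show "c *\<^sub>C (r *\<^sub>R v) = r *\<^sub>R (c *\<^sub>C v)"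
    by (simp only: scaleC_scaleC mult.commute flip: scaleC_of_real)
  show "\<exists>K. \<forall>c (v::'a). norm (c *\<^sub>C v) \<le> norm c * norm v * K"
    by (rule exI[of _ 1]) simp
qed (simp_all add: scaleC_add_left scaleC_add_right)

interpretation scaleC: bounded_bilinear "scaleC :: complex \<Rightarrow> 'a::complex_hilbert \<Rightarrow> 'a"
  by (rule bounded_bilinear_scaleC)

lemma scaleC_one [simp]: "1 *\<^sub>C (v::'a::complex_hilbert) = v"
  using scaleC_of_real[of 1 v] by simp

lemma scaleC_of_complex [simp]: "c *\<^sub>C (v::complex) = c * v"
  by (simp add: scaleC_complex_def)

lemma bounded_clinear_linear: "bounded_clinear f \<Longrightarrow> bounded_linear f"
  by (simp add: bounded_clinear_def)

lemma bounded_clinear_scaleC: "bounded_clinear f \<Longrightarrow> f (c *\<^sub>C v) = c *\<^sub>C f v"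
  by (simp add: bounded_clinear_def)

lemma bounded_clinear_add: "bounded_clinear f \<Longrightarrow> f (u + v) = f u + f v"
  by (simp add: bounded_clinear_def linear_simps)

lemma bounded_clinear_diff: "bounded_clinear f \<Longrightarrow> f (u - v) = f u - f v"
  by (simp add: bounded_clinear_def linear_simps)

lemma bounded_clinear_minus: "bounded_clinear f \<Longrightarrow> f (- v) = - f v"
  by (simp add: bounded_clinear_def linear_simps)

lemma bounded_clinear_zero: "bounded_clinear f \<Longrightarrow> f 0 = 0"
  by (simp add: bounded_clinear_def linear_simps)

lemmas bounded_clinear_simps = bounded_clinear_add bounded_clinear_diff bounded_clinear_minus
  bounded_clinear_zero bounded_clinear_scaleC

lemma bounded_clinear_compose:
  "bounded_clinear f \<Longrightarrow> bounded_clinear g \<Longrightarrow> bounded_clinear (\<lambda>v. f (g v))"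
  unfolding bounded_clinear_def by (auto intro: bounded_linear_compose)

lemma bounded_clinear_uminus: "bounded_clinear f \<Longrightarrow> bounded_clinear (\<lambda>v. - f v)"
  unfolding bounded_clinear_def by (auto intro: bounded_linear_minus simp: scaleC.minus_right)

lemma bounded_clinear_sub:
  "bounded_clinear f \<Longrightarrow> bounded_clinear g \<Longrightarrow> bounded_clinear (\<lambda>v. f v - g v)"
  unfolding bounded_clinear_def by (auto intro: bounded_linear_sub simp: scaleC.diff_right)

lemma bounded_clinear_scaleC_compose:
  assumes "bounded_clinear f" shows "bounded_clinear (\<lambda>v. c *\<^sub>C f v)"
  using assms unfolding bounded_clinear_def
  by (auto intro!: bounded_linear_compose[OF scaleC.bounded_linear_right] simp: scaleC_scaleC mult.commute)

lemma onorm_bound_clinear: "bounded_clinear f \<Longrightarrow> norm (f v) \<le> onorm f * norm v"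
  by (simp add: bounded_clinear_def onorm)

lemma bounded_clinearI:
  assumes "\<And>u v. f (u + v) = f u + f v" "\<And>c v. f (c *\<^sub>C v) = c *\<^sub>C f v"
    and "\<And>v. norm (f v) \<le> norm v * K"
  shows "bounded_clinear f"
  unfolding bounded_clinear_def
  by (auto intro!: bounded_linear_intro[of f K] assms) (metis assms(2) scaleC_of_real)

lemma bounded_clinear_cinner: "bounded_clinear (cinner (y::'a::complex_hilbert))"
  by (rule bounded_clinearI[of _ "norm y"])
     (auto simp: cinner_add_right cinner_scaleC_right norm_cinner_le mult.commute[of _ "norm y"])

text \<open>This is how estimates of matrix coefficients become estimates in norm: test against
  \<open>d\<close> itself.\<close>

lemma norm_le_if_cinner_le:
  fixes d :: "'a::complex_hilbert"
  assumes "\<And>y. cmod (cinner y d) \<le> c * norm y" "0 \<le> c"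
  shows "norm d \<le> c"
proof (cases "d = 0")
  case False
  have "norm d * norm d \<le> c * norm d"
    using assms(1)[of d] by (simp add: cinner_self power2_eq_square norm_mult)
  with False show ?thesis by simp
qed (use assms in simp)

lemma cinner_eqI:
  fixes u v :: "'a::complex_hilbert"
  assumes "\<And>y. cinner y u = cinner y v"
  shows "u = v"
  using norm_le_if_cinner_le[of "u - v" 0]
  by (simp add: assms bounded_clinear_diff[OF bounded_clinear_cinner])

section \<open>Complex differentiation of vectors and operators\<close>

text \<open>Complex differentiability of Hilbert-space valued functions; for complex-valued ones it is
  \<open>has_field_derivative\<close>.\<close>

definition has_vderiv :: "(complex \<Rightarrow> 'a::complex_hilbert) \<Rightarrow> 'a \<Rightarrow> complex \<Rightarrow> bool" where
  "has_vderiv u d z \<longleftrightarrow> ((\<lambda>h. inverse h *\<^sub>C (u (z + h) - u z)) \<longlongrightarrow> d) (at 0)"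

lemma has_vderiv_unique: "has_vderiv u d z \<Longrightarrow> has_vderiv u d' z \<Longrightarrow> d = d'"
  unfolding has_vderiv_def by (rule tendsto_unique) auto

lemma has_vderiv_const: "has_vderiv (\<lambda>z. c) 0 z"
  by (simp add: has_vderiv_def scaleC.zero_right)

lemma has_vderiv_add:
  "has_vderiv u d z \<Longrightarrow> has_vderiv v e z \<Longrightarrow> has_vderiv (\<lambda>z. u z + v z) (d + e) z"
  unfolding has_vderiv_def
  by (drule (1) tendsto_add) (simp add: algebra_simps scaleC.add_right scaleC.diff_right)

lemma has_vderiv_diff:
  "has_vderiv u d z \<Longrightarrow> has_vderiv v e z \<Longrightarrow> has_vderiv (\<lambda>z. u z - v z) (d - e) z"
  unfolding has_vderiv_def
  by (drule (1) tendsto_diff) (simp add: algebra_simps scaleC.add_right scaleC.diff_right)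

lemma has_vderiv_bounded_clinear:
  assumes "bounded_clinear f" "has_vderiv u d z"
  shows "has_vderiv (\<lambda>z. f (u z)) (f d) z"
proof -
  have "((\<lambda>h. f (inverse h *\<^sub>C (u (z + h) - u z))) \<longlongrightarrow> f d) (at 0)"
    by (rule bounded_linear.tendsto[OF bounded_clinear_linear[OF assms(1)]
          assms(2)[unfolded has_vderiv_def]])
  then show ?thesis
    by (simp add: has_vderiv_def bounded_clinear_simps[OF assms(1)])
qed

lemma eventually_at_0_in_open:
  fixes z :: complex
  assumes "open S" "z \<in> S"
  shows "\<forall>\<^sub>F h in at 0. z + h \<in> S"
proof -
  have "((\<lambda>h. z + h) \<longlongrightarrow> z) (at 0)" by (auto intro!: tendsto_eq_intros)
  then show ?thesis using assms by (rule topological_tendstoD)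
qed

lemma has_vderiv_transform:
  assumes "has_vderiv u d z" "open S" "z \<in> S" "\<And>y. y \<in> S \<Longrightarrow> u y = v y"
  shows "has_vderiv v d z"
  using assms(1) unfolding has_vderiv_def
  by (rule Lim_transform_eventually)
     (use eventually_at_0_in_open[OF assms(2,3)] assms(3,4) in \<open>auto elim!: eventually_mono\<close>)

lemma has_vderiv_field:
  fixes u :: "complex \<Rightarrow> complex"
  shows "has_vderiv u d z \<longleftrightarrow> (u has_field_derivative d) (at z)"
  by (simp add: has_vderiv_def DERIV_def divide_inverse mult.commute)

lemma has_vderiv_shift:
  assumes "has_vderiv u d (z + c)"
  shows "has_vderiv (\<lambda>z. u (z + c)) d z"
  using assms unfolding has_vderiv_def by (simp add: algebra_simps)

lemma has_vderiv_isCont: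
  assumes "has_vderiv u d z"
  shows "((\<lambda>h. u (z + h)) \<longlongrightarrow> u z) (at 0)"
proof -
  have "((\<lambda>h. h *\<^sub>C (inverse h *\<^sub>C (u (z + h) - u z)) + u z) \<longlongrightarrow> 0 *\<^sub>C d + u z) (at 0)"
    using assms unfolding has_vderiv_def
    by (intro tendsto_add tendsto_const scaleC.tendsto) auto
  then have "((\<lambda>h. h *\<^sub>C (inverse h *\<^sub>C (u (z + h) - u z)) + u z) \<longlongrightarrow> u z) (at 0)"
    by (simp add: scaleC.zero_left)
  then show ?thesis
    by (rule Lim_transform_eventually)
       (auto simp: eventually_at_filter scaleC_scaleC)
qed

text \<open>The derivative seen along the real axis from the right. This is the link with generators
  of semigroups, which are one-sided derivatives in a real variable.\<close>

lemma has_vderiv_right: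
  assumes "has_vderiv u d z"
  shows "((\<lambda>t. (u (z + complex_of_real t) - u z) /\<^sub>R t) \<longlongrightarrow> d) (at_right 0)"
proof -
  have "filterlim complex_of_real (at 0) (at_right 0)"
    by (auto simp: filterlim_at eventually_at_filter intro!: tendsto_eq_intros)
  from filterlim_compose[OF assms[unfolded has_vderiv_def] this]
  show ?thesis
    by (simp flip: of_real_inverse add: scaleC_of_real)
qed

definition has_opderiv ::
  "(complex \<Rightarrow> 'a::complex_hilbert \<Rightarrow> 'b::complex_hilbert) \<Rightarrow> ('a \<Rightarrow> 'b) \<Rightarrow> complex \<Rightarrow> bool" where
  "has_opderiv G G' z \<longleftrightarrow> bounded_clinear G' \<and>
     ((\<lambda>h. onorm (\<lambda>v. inverse h *\<^sub>C (G (z + h) v - G z v) - G' v)) \<longlongrightarrow> 0) (at 0)"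

lemma op_holomorphic_on_alt:
  "op_holomorphic_on G \<Omega> \<longleftrightarrow>
     (\<forall>z\<in>\<Omega>. bounded_clinear (G z)) \<and> (\<forall>z\<in>\<Omega>. \<exists>G'. has_opderiv G G' z)"
  by (simp add: op_holomorphic_on_def has_opderiv_def)

lemma bounded_clinear_diffquot:
  assumes "bounded_clinear f" "bounded_clinear g" "bounded_clinear k"
  shows "bounded_clinear (\<lambda>v. c *\<^sub>C (f v - g v) - k v)"
  by (intro bounded_clinear_sub bounded_clinear_scaleC_compose assms)

text \<open>Convergence of the difference quotients of \<open>G\<close> in operator norm allows the argument to
  move at the same time.\<close>

lemma has_opderiv_product:
  assumes S: "open S" "z \<in> S" and G: "\<And>y. y \<in> S \<Longrightarrow> bounded_clinear (G y)"
    and G': "has_opderiv G G' z" and u: "has_vderiv u d z"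
  shows "has_vderiv (\<lambda>y. G y (u y)) (G' (u z) + G z d) z"
proof -
  define Q where "Q h v = inverse h *\<^sub>C (G (z + h) v - G z v) - G' v" for h v
  have lG': "bounded_clinear G'" and lim: "((\<lambda>h. onorm (Q h)) \<longlongrightarrow> 0) (at 0)"
    using G' by (auto simp: has_opderiv_def Q_def[abs_def])
  have uc: "((\<lambda>h. u (z + h)) \<longlongrightarrow> u z) (at 0)" by (rule has_vderiv_isCont[OF u])
  have 1: "((\<lambda>h. Q h (u (z + h))) \<longlongrightarrow> 0) (at 0)"
  proof (rule Lim_null_comparison)
    show "((\<lambda>h. onorm (Q h) * norm (u (z + h))) \<longlongrightarrow> 0) (at 0)"
      using tendsto_mult[OF lim tendsto_norm[OF uc]] by simp
    show "\<forall>\<^sub>F h in at 0. norm (Q h (u (z + h))) \<le> onorm (Q h) * norm (u (z + h))"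
      using eventually_at_0_in_open[OF S]
    proof eventually_elim
      case (elim h)
      have "bounded_clinear (Q h)"
        unfolding Q_def[abs_def] by (intro bounded_clinear_diffquot G S elim lG')
      then show ?case by (rule onorm_bound_clinear)
    qed
  qed
  have 2: "((\<lambda>h. G' (u (z + h))) \<longlongrightarrow> G' (u z)) (at 0)"
    using bounded_linear.tendsto[OF bounded_clinear_linear[OF lG'] uc] .
  have 3: "((\<lambda>h. G z (inverse h *\<^sub>C (u (z + h) - u z))) \<longlongrightarrow> G z d) (at 0)"
    using bounded_linear.tendsto[OF bounded_clinear_linear[OF G[OF S(2)]]] u
    unfolding has_vderiv_def by blast
  have "((\<lambda>h. Q h (u (z + h)) + G' (u (z + h)) + G z (inverse h *\<^sub>C (u (z + h) - u z))) \<longlongrightarrow>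
      0 + G' (u z) + G z d) (at 0)"
    by (intro tendsto_add 1 2 3)
  then show ?thesis
    by (simp add: has_vderiv_def Q_def bounded_clinear_simps[OF G[OF S(2)]] flip: scaleC.add_right)
qed

lemma has_opderiv_vderiv:
  assumes "open S" "z \<in> S" "\<And>y. y \<in> S \<Longrightarrow> bounded_clinear (G y)" "has_opderiv G G' z"
  shows "has_vderiv (\<lambda>y. G y v) (G' v) z"
  using has_opderiv_product[OF assms has_vderiv_const[of v]]
  by (simp add: bounded_clinear_zero[OF assms(3)[OF assms(2)]])

text \<open>Taylor expansion of \<open>deriv f\<close> at \<open>z\<close>, with the third derivative controlled on the half
  ball by Cauchy's inequality on circles of radius $\rho/2$; this is where
  $48 = 3!\cdot 2^3$ comes from. What matters later is that the bound depends on \<open>f\<close> only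
  through \<open>N\<close>.\<close>

lemma deriv_quotient_error:
  assumes hol: "f holomorphic_on ball z \<rho>" and "\<rho> > 0"
    and bd: "\<And>y. y \<in> ball z \<rho> \<Longrightarrow> cmod (f y) \<le> N"
    and h: "h \<noteq> 0" "cmod h < \<rho> / 2"
  shows "cmod (inverse h * (deriv f (z + h) - deriv f z) - deriv (deriv f) z) \<le> 48 * N / \<rho> ^ 3 * cmod h"
proof -
  define B where "B = 48 * N / \<rho> ^ 3"
  define F where "F i = (deriv ^^ Suc i) f" for i
  have holF: "(deriv ^^ i) f holomorphic_on ball z \<rho>" for i
    by (intro holomorphic_higher_deriv hol) auto
  have der: "(F i has_field_derivative F (Suc i) y) (at y within ball z (\<rho>/2))"
    if "y \<in> ball z (\<rho>/2)" for i y
  proof -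
    have "y \<in> ball z \<rho>" using that \<open>\<rho> > 0\<close> by auto
    from holomorphic_derivI[OF holF[of "Suc i"] open_ball this]
    show ?thesis
      unfolding F_def by (auto intro: has_field_derivative_at_within)
  qed
  have bound: "cmod (F (Suc 1) y) \<le> B" if y: "y \<in> ball z (\<rho>/2)" for y
  proof -
    have sub: "cball y (\<rho>/2) \<subseteq> ball z \<rho>"
    proof
      fix x assume "x \<in> cball y (\<rho>/2)"
      with y show "x \<in> ball z \<rho>"
        using dist_triangle[of z x y] by (auto simp: dist_commute)
    qed
    have "cmod ((deriv ^^ 3) f y) \<le> fact 3 * N / (\<rho>/2) ^ 3"
    proof (rule Cauchy_inequality)
      show "f holomorphic_on ball y (\<rho>/2)"
        using hol sub ball_subset_cball holomorphic_on_subset by (meson order_trans)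
      show "continuous_on (cball y (\<rho>/2)) f"
        using hol sub by (meson continuous_on_subset holomorphic_on_imp_continuous_on)
      show "cmod (f x) \<le> N" if "cmod (y - x) = \<rho>/2" for x
        using bd[of x] sub that by (auto simp: dist_norm subset_iff)
    qed (use \<open>\<rho> > 0\<close> in auto)
    then show ?thesis
      by (simp add: F_def B_def numeral_3_eq_3 fact_numeral power_divide)
  qed
  have "cmod (F 0 (z + h) - (\<Sum>i\<le>1. F i z * (z + h - z) ^ i / fact i)) \<le> B * cmod (z + h - z) ^ Suc 1 / fact 1"
    by (rule complex_Taylor[of "ball z (\<rho>/2)"])
       (use der bound h \<open>\<rho> > 0\<close> in \<open>auto simp: dist_norm\<close>)
  then have "cmod (deriv f (z + h) - deriv f z - deriv (deriv f) z * h) \<le> B * cmod h ^ 2"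
    by (simp add: F_def algebra_simps power2_eq_square)
  then have "cmod (inverse h * (deriv f (z + h) - deriv f z - deriv (deriv f) z * h)) \<le> inverse (cmod h) * (B * cmod h ^ 2)"
    unfolding norm_mult norm_inverse by (rule mult_left_mono) auto
  then show ?thesis
    using h by (simp add: B_def field_simps power2_eq_square)
qed

text \<open>A Cauchy criterion at 0 that comes with a rate.\<close>

lemma limit_at_0_if_almost_constant:
  fixes q :: "complex \<Rightarrow> 'a::banach"
  assumes "\<delta> > 0"
    and q: "\<And>h k. h \<noteq> 0 \<Longrightarrow> k \<noteq> 0 \<Longrightarrow> cmod h < \<delta> \<Longrightarrow> cmod k < \<delta> \<Longrightarrow>
        norm (q h - q k) \<le> c * (cmod h + cmod k)"
  shows "\<exists>l. \<forall>h. h \<noteq> 0 \<longrightarrow> cmod h < \<delta> \<longrightarrow> norm (q h - l) \<le> c * cmod h"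
proof -
  define s where "s n = complex_of_real (\<delta> / (real n + 2))" for n
  have s3: "cmod (s n) = \<delta> / (real n + 2)" for n
    using \<open>\<delta> > 0\<close> unfolding s_def norm_of_real by simp
  have s2: "cmod (s n) < \<delta>" for n
  proof -
    have "\<delta> * 1 < \<delta> * (real n + 2)" using \<open>\<delta> > 0\<close> by (intro mult_strict_left_mono) auto
    then show ?thesis by (simp add: s3 divide_less_eq)
  qed
  have s1: "s n \<noteq> 0" for n
    using s3[of n] \<open>\<delta> > 0\<close> by auto
  note s = s1 s2 s3
  have s0: "(\<lambda>n. cmod (s n)) \<longlonglongrightarrow> 0"
    unfolding s(3) by real_asymp
  have c: "c \<ge> 0"
    using q[of "s 0" "s 0"] s[of 0] \<open>\<delta> > 0\<close> by (auto simp: zero_le_mult_iff)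
  have "Cauchy (\<lambda>n. q (s n))"
  proof (rule CauchyI)
    fix e :: real assume "e > 0"
    have "(\<lambda>n. c * cmod (s n)) \<longlonglongrightarrow> c * 0" by (intro tendsto_intros s0)
    then have "\<forall>\<^sub>F n in sequentially. c * cmod (s n) < e / 2"
      using \<open>e > 0\<close> by (intro order_tendstoD) auto
    then obtain N where N: "\<And>n. n \<ge> N \<Longrightarrow> c * cmod (s n) < e / 2"
      by (auto simp: eventually_sequentially)
    show "\<exists>M. \<forall>m\<ge>M. \<forall>n\<ge>M. norm (q (s m) - q (s n)) < e"
    proof (intro exI allI impI)
      fix m n assume "m \<ge> N" "n \<ge> N"
      then show "norm (q (s m) - q (s n)) < e"
        using q[OF s(1,1) s(2,2), of m n] N[of m] N[of n] by (simp add: distrib_left)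
    qed
  qed
  then obtain l where l: "(\<lambda>n. q (s n)) \<longlonglongrightarrow> l"
    using Cauchy_convergent convergent_def by blast
  have "norm (q h - l) \<le> c * cmod h" if "h \<noteq> 0" "cmod h < \<delta>" for h
  proof (rule LIMSEQ_le)
    show "(\<lambda>n. norm (q h - q (s n))) \<longlonglongrightarrow> norm (q h - l)" by (intro tendsto_intros l)
    have "(\<lambda>n. c * (cmod h + cmod (s n))) \<longlonglongrightarrow> c * (cmod h + 0)" by (intro tendsto_intros s0)
    then show "(\<lambda>n. c * (cmod h + cmod (s n))) \<longlonglongrightarrow> c * cmod h" by simp
    show "\<exists>N. \<forall>n\<ge>N. norm (q h - q (s n)) \<le> c * (cmod h + cmod (s n))"
      using q[OF that(1) s(1) that(2) s(2)] by blast
  qed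
  then show ?thesis by blast
qed

text \<open>Differentiability at one point bounds the operator norms in a neighbourhood of it, because
  the difference quotients are eventually within 1 of \<open>G'\<close>.\<close>

lemma has_opderiv_bounded_nearby:
  assumes "open S" "z \<in> S" and G: "\<And>y. y \<in> S \<Longrightarrow> bounded_clinear (G y)"
    and G': "has_opderiv G G' z"
  obtains \<rho> M where "\<rho> > 0" "M \<ge> 0" "ball z \<rho> \<subseteq> S" "\<And>y. y \<in> ball z \<rho> \<Longrightarrow> onorm (G y) \<le> M"
proof -
  define Q where "Q h v = inverse h *\<^sub>C (G (z + h) v - G z v) - G' v" for h v
  have lG': "bounded_clinear G'" and lim: "((\<lambda>h. onorm (Q h)) \<longlongrightarrow> 0) (at 0)"
    using G' by (auto simp: has_opderiv_def Q_def[abs_def])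
  have "\<forall>\<^sub>F h in at 0. onorm (Q h) < 1 \<and> z + h \<in> S"
    using order_tendstoD(2)[OF lim, of 1] eventually_at_0_in_open[OF assms(1,2)]
    by (auto intro: eventually_conj)
  then obtain d where d: "d > 0" "\<And>h. h \<noteq> 0 \<Longrightarrow> cmod h < d \<Longrightarrow> onorm (Q h) < 1 \<and> z + h \<in> S"
    by (auto simp: eventually_at dist_norm)
  define M where "M = onorm (G z) + onorm G' + 1"
  have nonneg: "0 \<le> onorm (G z)" "0 \<le> onorm G'"
    using G[OF assms(2)] lG' by (auto intro!: onorm_pos_le bounded_clinear_linear)
  have bound: "norm (G y v) \<le> M * norm v" if y: "y \<in> ball z (min d 1)" for y v
  proof (cases "y = z")
    case True
    have "norm (G z v) \<le> onorm (G z) * norm v" by (intro onorm_bound_clinear G assms)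
    also have "\<dots> \<le> M * norm v" using nonneg by (intro mult_right_mono) (auto simp: M_def)
    finally show ?thesis using True by simp
  next
    case False
    define h where "h = y - z"
    have h: "h \<noteq> 0" "cmod h < d" "cmod h \<le> 1" "y = z + h"
      using False y by (auto simp: h_def dist_norm norm_minus_commute)
    have Qh: "onorm (Q h) < 1" "z + h \<in> S" using d(2)[OF h(1,2)] by auto
    have lQ: "bounded_clinear (Q h)"
      unfolding Q_def[abs_def] by (intro bounded_clinear_diffquot G Qh assms lG')
    have "G y v = G z v + h *\<^sub>C (Q h v + G' v)"
      using h by (simp add: Q_def scaleC_scaleC)
    then have "norm (G y v) \<le> norm (G z v) + norm (h *\<^sub>C (Q h v + G' v))"
      by (metis norm_triangle_ineq)
    also have "\<dots> \<le> norm (G z v) + 1 * (norm (Q h v) + norm (G' v))"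
      unfolding norm_scaleC by (intro add_left_mono mult_mono h norm_triangle_ineq) auto
    also have "norm (G z v) \<le> onorm (G z) * norm v" by (intro onorm_bound_clinear G assms)
    also have "norm (Q h v) \<le> onorm (Q h) * norm v" by (intro onorm_bound_clinear lQ)
    also have "\<dots> \<le> 1 * norm v" using Qh(1) by (intro mult_right_mono) auto
    also have "norm (G' v) \<le> onorm G' * norm v" by (intro onorm_bound_clinear lG')
    finally show ?thesis by (simp add: M_def algebra_simps)
  qed
  show ?thesis
  proof (rule that[of "min d 1" M])
    show "ball z (min d 1) \<subseteq> S"
    proof
      fix y assume "y \<in> ball z (min d 1)"
      then show "y \<in> S"
        using d(2)[of "y - z"] assms(2) by (cases "y = z") (auto simp: dist_norm norm_minus_commute)
    qed
    show "onorm (G y) \<le> M" if "y \<in> ball z (min d 1)" for y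
      by (rule onorm_bound) (use bound[OF that] nonneg in \<open>auto simp: M_def\<close>)
  qed (use d nonneg in \<open>auto simp: M_def\<close>)
qed

text \<open>For fixed \<open>y\<close> and \<open>v\<close> the function \<open>\<lambda>x. cinner y (G x v)\<close> is an ordinary holomorphic
  function, bounded near \<open>z\<close> by a multiple of \<open>norm y * norm v\<close>. Cauchy estimates for it bound the
  variation of the difference quotients of its derivative by the same multiple. As the bound is
  uniform in \<open>y\<close> and \<open>v\<close>, the difference quotients of \<open>G'\<close> converge in operator norm.\<close>

lemma op_holomorphic_deriv:
  fixes G :: "complex \<Rightarrow> 'a::complex_hilbert \<Rightarrow> 'b::complex_hilbert"
  assumes "op_holomorphic_on G \<Omega>" and \<Omega>: "open \<Omega>"
    and G': "\<And>z. z \<in> \<Omega> \<Longrightarrow> has_opderiv G (G' z) z"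
  shows "op_holomorphic_on G' \<Omega>"
  unfolding op_holomorphic_on_alt
proof (intro conjI ballI)
  have G: "bounded_clinear (G z)" if "z \<in> \<Omega>" for z
    using assms(1) that by (simp add: op_holomorphic_on_alt)
  show lG': "bounded_clinear (G' z)" if "z \<in> \<Omega>" for z
    using G'[OF that] by (simp add: has_opderiv_def)
  fix z assume z: "z \<in> \<Omega>"
  obtain \<rho> M where \<rho>: "\<rho> > 0" and M: "M \<ge> 0" and sub: "ball z \<rho> \<subseteq> \<Omega>"
    and bd: "\<And>y. y \<in> ball z \<rho> \<Longrightarrow> onorm (G y) \<le> M"
    using has_opderiv_bounded_nearby[OF \<Omega> z G G'[OF z]] by metis
  define q where "q h v = inverse h *\<^sub>C (G' (z + h) v - G' z v)" for h v
  define K where "K = 48 * M / \<rho> ^ 3"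
  have K: "K \<ge> 0" using M \<rho> by (simp add: K_def)
  have weak: "\<exists>s. \<forall>h. h \<noteq> 0 \<longrightarrow> cmod h < \<rho>/2 \<longrightarrow> cmod (cinner y (q h v) - s) \<le> K * norm v * norm y * cmod h"
    for y :: 'b and v :: 'a
  proof -
    define f where "f x = cinner y (G x v)" for x
    have der: "(f has_field_derivative cinner y (G' x v)) (at x)" if "x \<in> \<Omega>" for x
      using has_vderiv_bounded_clinear[OF bounded_clinear_cinner has_opderiv_vderiv[OF \<Omega> that G G'[OF that]]]
      unfolding has_vderiv_field f_def[abs_def] .
    have hol: "f holomorphic_on ball z \<rho>"
      using der sub by (intro holomorphic_onI) (meson field_differentiable_at_within field_differentiable_def subsetD)
    have fb: "cmod (f x) \<le> M * norm v * norm y" if "x \<in> ball z \<rho>" for x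
    proof -
      have "cmod (f x) \<le> norm y * norm (G x v)" unfolding f_def by (rule norm_cinner_le)
      also have "\<dots> \<le> norm y * (onorm (G x) * norm v)"
        using that sub by (intro mult_left_mono onorm_bound_clinear G) auto
      also have "\<dots> \<le> norm y * (M * norm v)"
        by (intro mult_left_mono mult_right_mono bd that) auto
      finally show ?thesis by (simp add: mult_ac)
    qed
    have "cmod (cinner y (q h v) - deriv (deriv f) z) \<le> K * norm v * norm y * cmod h"
      if h: "h \<noteq> 0" "cmod h < \<rho>/2" for h
    proof -
      have "z + h \<in> \<Omega>" using sub h \<rho> by (auto simp: dist_norm subset_iff)
      then have "cinner y (q h v) = inverse h * (deriv f (z + h) - deriv f z)"
        using DERIV_imp_deriv[OF der] z
        by (simp add: q_def cinner_scaleC_right bounded_clinear_diff[OF bounded_clinear_cinner])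
      then show ?thesis
        using deriv_quotient_error[OF hol \<rho> fb h] by (simp add: K_def mult_ac)
    qed
    then show ?thesis by blast
  qed
  have "\<exists>l. \<forall>h. h \<noteq> 0 \<longrightarrow> cmod h < \<rho>/2 \<longrightarrow> norm (q h v - l) \<le> (K * norm v) * cmod h" for v
  proof (rule limit_at_0_if_almost_constant)
    show "\<rho>/2 > 0" using \<rho> by simp
    fix h k assume h: "h \<noteq> 0" "k \<noteq> 0" "cmod h < \<rho>/2" "cmod k < \<rho>/2"
    show "norm (q h v - q k v) \<le> K * norm v * (cmod h + cmod k)"
    proof (rule norm_le_if_cinner_le)
      fix y
      obtain s where s: "\<forall>h. h \<noteq> 0 \<longrightarrow> cmod h < \<rho>/2 \<longrightarrow> cmod (cinner y (q h v) - s) \<le> K * norm v * norm y * cmod h"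
        using weak by blast
      have "cmod (cinner y (q h v - q k v)) = cmod ((cinner y (q h v) - s) - (cinner y (q k v) - s))"
        by (simp add: bounded_clinear_diff[OF bounded_clinear_cinner])
      also have "\<dots> \<le> cmod (cinner y (q h v) - s) + cmod (cinner y (q k v) - s)"
        by (rule norm_triangle_ineq4)
      also have "\<dots> \<le> K * norm v * norm y * cmod h + K * norm v * norm y * cmod k"
        using s h by (intro add_mono) auto
      finally show "cmod (cinner y (q h v - q k v)) \<le> K * norm v * (cmod h + cmod k) * norm y"
        by (simp add: algebra_simps)
    qed (use K in auto)
  qed
  then obtain G2 where G2: "\<And>v h. h \<noteq> 0 \<Longrightarrow> cmod h < \<rho>/2 \<Longrightarrow> norm (q h v - G2 v) \<le> K * norm v * cmod h"
    by metis
  have zh: "z + h \<in> \<Omega>" if "cmod h < \<rho>/2" for h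
    using sub that \<rho> by (auto simp: dist_norm subset_iff)
  have lq: "bounded_clinear (q h)" if "cmod h < \<rho>/2" for h
    unfolding q_def[abs_def]
    by (intro bounded_clinear_scaleC_compose bounded_clinear_sub lG' z zh that)
  have ev: "\<forall>\<^sub>F h in at 0. h \<noteq> 0 \<and> cmod h < \<rho>/2"
    unfolding eventually_at using \<rho> by (intro exI[of _ "\<rho>/2"]) (auto simp: dist_norm)
  have lim: "((\<lambda>h. q h v) \<longlongrightarrow> G2 v) (at 0)" for v
  proof (rule Lim_null[THEN iffD2], rule Lim_null_comparison)
    show "\<forall>\<^sub>F h in at 0. norm (q h v - G2 v) \<le> K * norm v * cmod h"
      using ev by eventually_elim (use G2 in blast)
    have "((\<lambda>h. K * norm v * cmod h) \<longlongrightarrow> K * norm v * cmod 0) (at (0::complex))"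
      by (intro tendsto_intros)
    then show "((\<lambda>h. K * norm v * cmod h) \<longlongrightarrow> 0) (at (0::complex))" by simp
  qed
  have lG2: "bounded_clinear G2"
  proof (rule bounded_clinearI)
    show "G2 (u + v) = G2 u + G2 v" for u v
    proof (rule tendsto_unique[OF _ lim])
      show "((\<lambda>h. q h (u + v)) \<longlongrightarrow> G2 u + G2 v) (at 0)"
        by (rule Lim_transform_eventually[OF tendsto_add[OF lim lim]])
           (use ev in \<open>auto elim!: eventually_mono simp: bounded_clinear_add[OF lq]\<close>)
    qed auto
    show "G2 (c *\<^sub>C v) = c *\<^sub>C G2 v" for c v
    proof (rule tendsto_unique[OF _ lim])
      show "((\<lambda>h. q h (c *\<^sub>C v)) \<longlongrightarrow> c *\<^sub>C G2 v) (at 0)"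
        by (rule Lim_transform_eventually[OF scaleC.tendsto[OF tendsto_const lim]])
           (use ev in \<open>auto elim!: eventually_mono simp: bounded_clinear_scaleC[OF lq]\<close>)
    qed auto
    \<comment> \<open>any one admissible difference quotient bounds the limit operator\<close>
    define h where "h = complex_of_real (\<rho>/4)"
    have h: "h \<noteq> 0" "cmod h < \<rho>/2" using \<rho> unfolding h_def norm_of_real by auto
    show "norm (G2 v) \<le> norm v * (onorm (q h) + K * cmod h)" for v
      using G2[OF h, of v] onorm_bound_clinear[OF lq[OF h(2)], of v]
        norm_triangle_ineq4[of "q h v" "q h v - G2 v"]
      by (simp add: algebra_simps)
  qed
  have "((\<lambda>h. onorm (\<lambda>v. q h v - G2 v)) \<longlongrightarrow> 0) (at 0)"
  proof (rule Lim_null_comparison)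
    show "\<forall>\<^sub>F h in at 0. norm (onorm (\<lambda>v. q h v - G2 v)) \<le> K * cmod h"
      using ev
    proof eventually_elim
      case (elim h)
      have "onorm (\<lambda>v. q h v - G2 v) \<le> K * cmod h"
        by (rule onorm_bound) (use G2 elim K in \<open>simp_all add: mult_ac\<close>)
      moreover have "0 \<le> onorm (\<lambda>v. q h v - G2 v)"
        using elim by (intro onorm_pos_le bounded_clinear_linear bounded_clinear_sub lq lG2) auto
      ultimately show ?case by simp
    qed
    have "((\<lambda>h. K * cmod h) \<longlongrightarrow> K * cmod 0) (at (0::complex))"
      by (intro tendsto_intros)
    then show "((\<lambda>h. K * cmod h) \<longlongrightarrow> 0) (at (0::complex))" by simp
  qed
  then show "\<exists>G2. has_opderiv G' G2 z"
    using lG2 unfolding has_opderiv_def q_def by blast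
qed

text \<open>The sign makes iterates of this operation on $e^{-zA}$ equal to $A^je^{-zA}$.\<close>

definition neg_opderiv ::
  "(complex \<Rightarrow> 'a::complex_hilbert \<Rightarrow> 'b::complex_hilbert) \<Rightarrow> complex \<Rightarrow> 'a \<Rightarrow> 'b" where
  "neg_opderiv G z v = - (SOME G'. has_opderiv G G' z) v"

lemma has_opderiv_uminus:
  assumes "has_opderiv G G' z"
  shows "has_opderiv (\<lambda>z v. - G z v) (\<lambda>v. - G' v) z"
proof -
  have *: "(\<lambda>v. inverse h *\<^sub>C (- G (z + h) v - - G z v) - - G' v) =
      (\<lambda>v. - (inverse h *\<^sub>C (G (z + h) v - G z v) - G' v))" for h
    by (simp add: scaleC.minus_right scaleC.diff_right fun_eq_iff algebra_simps)
  then show ?thesis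
    using assms unfolding has_opderiv_def * onorm_neg by (auto intro: bounded_clinear_uminus)
qed

lemma has_opderiv_neg_opderiv:
  assumes "has_opderiv G G' z"
  shows "has_opderiv G (\<lambda>v. - neg_opderiv G z v) z"
  using someI[of "\<lambda>G'. has_opderiv G G' z", OF assms] by (simp add: neg_opderiv_def)

lemma op_holomorphic_neg_opderiv:
  assumes "op_holomorphic_on G \<Omega>" "open \<Omega>"
  shows "op_holomorphic_on (neg_opderiv G) \<Omega>"
proof -
  have "has_opderiv G (\<lambda>v. - neg_opderiv G z v) z" if "z \<in> \<Omega>" for z
    using assms(1) that by (auto simp: op_holomorphic_on_alt intro: has_opderiv_neg_opderiv)
  from op_holomorphic_deriv[OF assms this]
  have *: "op_holomorphic_on (\<lambda>z v. - neg_opderiv G z v) \<Omega>" by simp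
  show ?thesis
    unfolding op_holomorphic_on_alt
  proof (intro conjI ballI)
    fix z assume z: "z \<in> \<Omega>"
    have "bounded_clinear (\<lambda>v. - neg_opderiv G z v)"
      using * z by (simp add: op_holomorphic_on_alt)
    from bounded_clinear_uminus[OF this] show "bounded_clinear (neg_opderiv G z)" by simp
    obtain G' where "has_opderiv (\<lambda>z v. - neg_opderiv G z v) G' z"
      using * z by (meson op_holomorphic_on_alt)
    from has_opderiv_uminus[OF this] show "\<exists>G'. has_opderiv (neg_opderiv G) G' z" by auto
  qed
qed

text \<open>The scalar identity theorem, applied to each matrix coefficient.\<close>

lemma vector_identity_theorem:
  fixes u v :: "complex \<Rightarrow> 'a::complex_hilbert"
  assumes \<Omega>: "open \<Omega>" "connected \<Omega>"
    and u: "\<And>z. z \<in> \<Omega> \<Longrightarrow> \<exists>d. has_vderiv u d z"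
    and v: "\<And>z. z \<in> \<Omega> \<Longrightarrow> \<exists>d. has_vderiv v d z"
    and eq: "\<And>t. t > r \<Longrightarrow> complex_of_real t \<in> \<Omega> \<and> u (complex_of_real t) = v (complex_of_real t)"
    and z: "z \<in> \<Omega>"
  shows "u z = v z"
proof (rule cinner_eqI)
  fix y
  define f where "f z = cinner y (u z - v z)" for z
  define \<xi> where "\<xi> = complex_of_real (r + 1)"
  have "\<exists>d. (f has_field_derivative d) (at z)" if z: "z \<in> \<Omega>" for z
  proof -
    obtain d e where "has_vderiv u d z" "has_vderiv v e z" using u[OF z] v[OF z] by blast
    from has_vderiv_bounded_clinear[OF bounded_clinear_cinner has_vderiv_diff[OF this]]
    show ?thesis unfolding f_def[abs_def] has_vderiv_field by blast
  qed
  then have hol: "f holomorphic_on \<Omega>"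
    by (intro holomorphic_onI) (meson field_differentiable_at_within field_differentiable_def)
  have "f z = 0"
  proof (rule analytic_continuation[OF hol \<Omega> _ _ _ _ z])
    show "complex_of_real ` {r<..} \<subseteq> \<Omega>" "\<xi> \<in> \<Omega>" using eq by (auto simp: \<xi>_def simp del: of_real_add)
    show "\<xi> islimpt complex_of_real ` {r<..}"
      unfolding islimpt_approachable
    proof (intro allI impI)
      fix e :: real assume "e > 0"
      then show "\<exists>x'\<in>complex_of_real ` {r<..}. x' \<noteq> \<xi> \<and> dist x' \<xi> < e"
        by (intro bexI[of _ "complex_of_real (r + 1 + e / 2)"])
           (auto simp: \<xi>_def dist_norm simp flip: of_real_diff simp del: of_real_add)
    qed
    show "f z = 0" if "z \<in> complex_of_real ` {r<..}" for z
      using eq that by (auto simp: f_def bounded_clinear_zero[OF bounded_clinear_cinner])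
  qed
  then show "cinner y (u z) = cinner y (v z)"
    by (simp add: f_def bounded_clinear_diff[OF bounded_clinear_cinner])
qed

section \<open>Sectors\<close>

text \<open>The description by an inequality avoids the discontinuity of \<open>Arg\<close>: openness and stability
  under positive dilations and translations can be read off.\<close>

lemma sector_eq_cone:
  assumes "0 < \<phi>" "\<phi> < pi"
  shows "sector \<phi> = {z. cos \<phi> * cmod z < Re z}"
proof (intro set_eqI)
  fix z :: complex
  show "z \<in> sector \<phi> \<longleftrightarrow> z \<in> {z. cos \<phi> * cmod z < Re z}"
  proof (cases "z = 0")
    case False
    have "\<bar>Arg z\<bar> < \<phi> \<longleftrightarrow> cos \<phi> < cos \<bar>Arg z\<bar>"
      using assms Arg_bounded[of z] by (intro cos_mono_less_eq[symmetric]) auto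
    moreover have "cos \<bar>Arg z\<bar> = Re z / cmod z"
      using cos_Arg[OF False] by simp
    ultimately show ?thesis using False by (simp add: sector_def pos_less_divide_eq)
  qed (simp add: sector_def)
qed

text \<open>A cone of this form is stable under \<open>z \<mapsto> z + t\<close> for \<open>t \<ge> 0\<close> because
  $|\cos\varphi| \le 1$ and \<open>cmod\<close> is 1-Lipschitz. Together with dilations this makes it starlike
  about 1, also when it is not convex.\<close>

lemma shifted_sector_properties:
  assumes "0 < \<phi>" "\<phi> < pi" and \<Omega>: "\<Omega> = {x. x - complex_of_real a \<in> sector \<phi>}"
  shows "open \<Omega>" "connected \<Omega>" "\<And>z t. z \<in> \<Omega> \<Longrightarrow> t \<ge> 0 \<Longrightarrow> z + complex_of_real t \<in> \<Omega>"
    "\<And>t. t > a \<Longrightarrow> complex_of_real t \<in> \<Omega>"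
proof -
  define S where "S = {z. cos \<phi> * cmod z < Re z}"
  have S: "\<Omega> = {x. x - complex_of_real a \<in> S}"
    using \<Omega> by (simp add: sector_eq_cone[OF assms(1,2)] S_def)
  have cos: "\<bar>cos \<phi>\<bar> \<le> 1" "cos \<phi> < 1"
    using cos_monotone_0_pi[of 0 \<phi>] assms by auto
  have add: "z + complex_of_real t \<in> S" if "z \<in> S" "t \<ge> 0" for z t
  proof -
    have "\<bar>cmod (z + complex_of_real t) - cmod z\<bar> \<le> t"
      using norm_triangle_ineq3[of "z + complex_of_real t" z] that by simp
    then have "\<bar>cos \<phi>\<bar> * \<bar>cmod (z + complex_of_real t) - cmod z\<bar> \<le> 1 * t"
      by (intro mult_mono cos) auto
    then have "cos \<phi> * (cmod (z + complex_of_real t) - cmod z) \<le> t"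
      by (simp flip: abs_mult)
    then show ?thesis using that by (simp add: S_def algebra_simps)
  qed
  have one: "1 \<in> S" using cos by (simp add: S_def)
  have scale: "complex_of_real s * z \<in> S" if "z \<in> S" "s > 0" for z s
    using that by (simp add: S_def norm_mult mult.left_commute)
  have "starlike S"
    unfolding starlike_def
  proof (intro bexI[OF _ one] ballI subsetI)
    fix z w assume z: "z \<in> S" and "w \<in> closed_segment 1 z"
    then obtain s where s: "0 \<le> s" "s \<le> 1" "w = complex_of_real s * z + complex_of_real (1 - s)"
      by (auto simp: in_segment scaleR_conv_of_real add.commute)
    show "w \<in> S"
    proof (cases "s = 0")
      case False
      then show ?thesis using s add[OF scale[OF z], of s "1 - s"] by simp
    qed (use s one in simp)
  qed
  then have conn: "connected S" by (rule starlike_imp_connected)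
  have img: "\<Omega> = (\<lambda>z. z + complex_of_real a) ` S"
    unfolding S by (auto simp: image_iff) (metis diff_add_cancel)
  show "connected \<Omega>" unfolding img
    by (rule connected_continuous_image[OF _ conn]) (intro continuous_intros)
  show "open \<Omega>" unfolding S S_def
    by (simp, intro open_Collect_less continuous_intros)
  show "z + complex_of_real t \<in> \<Omega>" if "z \<in> \<Omega>" "t \<ge> 0" for z t
    using add[of "z - complex_of_real a" t] that by (simp add: S algebra_simps)
  show "complex_of_real t \<in> \<Omega>" if "t > a" for t
    using scale[OF one, of "t - a"] that by (simp add: S)
qed

section \<open>Integrals over half-lines\<close>

text \<open>The fundamental theorem of calculus at the left end point, for values in an infinite
  dimensional space.\<close>

lemma set_integral_initial_average:
  fixes g :: "real \<Rightarrow> 'a::{banach,second_countable_topology}"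
  assumes cont: "continuous_on {0..} g"
  shows "((\<lambda>h. (LINT s:{0..<h}|lborel. g s) /\<^sub>R h) \<longlongrightarrow> g 0) (at_right 0)"
proof (rule tendstoI)
  fix e :: real assume e: "e > 0"
  have "(g \<longlongrightarrow> g 0) (at 0 within {0..})" using cont by (simp add: continuous_on_def)
  then have "\<forall>\<^sub>F s in at 0 within {0..}. dist (g s) (g 0) < e / 2"
    using e by (intro tendstoD) auto
  then obtain d where d: "d > 0" "\<And>s. s > 0 \<Longrightarrow> s < d \<Longrightarrow> dist (g s) (g 0) < e / 2"
    by (auto simp: eventually_at)
  have "dist ((LINT s:{0..<h}|lborel. g s) /\<^sub>R h) (g 0) < e" if h: "0 < h" "h < d" for h
  proof -
    have int: "set_integrable lborel {0..<h} g"
      by (rule set_integrable_subset[OF borel_integrable_atLeastAtMost'[of 0 h]])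
         (auto intro: continuous_on_subset[OF cont])
    have intc: "set_integrable lborel {0..<h} (\<lambda>s. c)" for c :: "'c::{banach,second_countable_topology}"
      by (rule set_integrable_subset[OF borel_integrable_atLeastAtMost'[of 0 h]]) auto
    have const: "(LINT s:{0..<h}|lborel. c) = h *\<^sub>R c" for c :: "'c::{banach,second_countable_topology}"
      using h by (simp add: set_lebesgue_integral_def)
    have "norm ((LINT s:{0..<h}|lborel. g s) - h *\<^sub>R g 0) = norm (LINT s:{0..<h}|lborel. g s - g 0)"
      by (simp add: set_integral_diff[OF int intc] const)
    also have "\<dots> \<le> (LINT s:{0..<h}|lborel. e / 2)"
      unfolding set_lebesgue_integral_def
    proof (rule Bochner_Integration.integral_norm_bound_integral)
      show "integrable lborel (\<lambda>s. indicator {0..<h} s *\<^sub>R (g s - g 0))"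
        using set_integral_diff(1)[OF int intc] by (simp add: set_integrable_def)
      show "integrable lborel (\<lambda>s. indicator {0..<h} s *\<^sub>R (e / 2))"
        using intc unfolding set_integrable_def .
      show "norm (indicator {0..<h} s *\<^sub>R (g s - g 0)) \<le> indicator {0..<h} s *\<^sub>R (e / 2)" for s
        using d(2)[of s] h e by (cases "s = 0") (auto simp: indicator_def dist_norm)
    qed
    also have "\<dots> = h * (e / 2)" using const[of "e / 2"] by simp
    finally have "norm ((LINT s:{0..<h}|lborel. g s) - h *\<^sub>R g 0) / h \<le> e / 2"
      using h by (simp add: field_simps)
    moreover have "(LINT s:{0..<h}|lborel. g s) /\<^sub>R h - g 0 = ((LINT s:{0..<h}|lborel. g s) - h *\<^sub>R g 0) /\<^sub>R h"
    proof -
      have "inverse h * h = 1" using h by simp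
      then show ?thesis by (simp only: scaleR_diff_right scaleR_scaleR scaleR_one)
    qed
    ultimately have "dist ((LINT s:{0..<h}|lborel. g s) /\<^sub>R h) (g 0) \<le> e / 2"
      using h(1) unfolding dist_norm
      by (simp only: norm_scaleR abs_inverse abs_of_pos mult.commute[of "inverse h"] divide_inverse[symmetric])
    then show ?thesis using e by linarith
  qed
  then show "\<forall>\<^sub>F h in at_right 0. dist ((LINT s:{0..<h}|lborel. g s) /\<^sub>R h) (g 0) < e"
    using d(1) by (auto simp: eventually_at_right_field)
qed

lemma set_integrable_exp_decay:
  fixes \<omega> :: real
  assumes "\<omega> > 0"
  shows "set_integrable lborel {0..} (\<lambda>s. exp (- (\<omega> * s)))"
proof -
  have "(\<integral>\<^sup>+s. ennreal (exp (- (\<omega> * s))) * indicator {0..} s \<partial>lborel) = ennreal (0 - (- exp (- (\<omega> * 0)) / \<omega>))"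
  proof (rule nn_integral_FTC_atLeast)
    show "((\<lambda>s. - exp (- (\<omega> * s)) / \<omega>) \<longlongrightarrow> 0) at_top"
      using assms by real_asymp
    show "((\<lambda>s. - exp (- (\<omega> * s)) / \<omega>) has_real_derivative exp (- (\<omega> * s))) (at s)" for s
      using assms by (auto intro!: derivative_eq_intros)
  qed auto
  then show ?thesis
    unfolding set_integrable_def
    by (intro integrableI_nonneg) (auto simp: mult.commute ennreal_mult'' ennreal_indicator[symmetric])
qed

lemma set_integral_bounded_linear:
  fixes f :: "real \<Rightarrow> 'a::{banach,second_countable_topology}"
    and g :: "'a \<Rightarrow> 'b::{banach,second_countable_topology}"
  assumes "bounded_linear g" "set_integrable lborel S f"
  shows "(LINT s:S|lborel. g (f s)) = g (LINT s:S|lborel. f s)"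
  using integral_bounded_linear[OF assms(1) assms(2)[unfolded set_integrable_def]]
  by (simp add: set_lebesgue_integral_def linear_simps[OF assms(1)])

section \<open>The semigroup and the smooth vectors of its generator\<close>

text \<open>A linear system with scalar input and output whose semigroup decays, on a domain
  where the semigroup can be continued: translation invariance lets the semigroup law be stated for
  complex times, and the ray of real points is where the identity theorem starts.\<close>

locale continued_system =
  fixes A :: "'h::{complex_hilbert,second_countable_topology} \<Rightarrow> 'h"
    and D :: "'h set"
    and T :: "real \<Rightarrow> 'h \<Rightarrow> 'h"
    and B :: "complex \<Rightarrow> 'h"
    and C :: "'h \<Rightarrow> complex"
    and E :: "complex \<Rightarrow> 'h \<Rightarrow> 'h"
    and t0 r :: real
    and \<Omega> :: "complex set"
  assumes system: "linear_system D A T B C"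
    and decay: "t0 > 0" "onorm (T t0) < 1"
    and domain: "open \<Omega>" "connected \<Omega>"
    and shift: "\<And>z t. z \<in> \<Omega> \<Longrightarrow> t \<ge> 0 \<Longrightarrow> z + complex_of_real t \<in> \<Omega>"
    and ray: "\<And>t. t > r \<Longrightarrow> complex_of_real t \<in> \<Omega>"
    and holomorphic: "holomorphic_system_on T B C E \<Omega>"
begin

lemma T_clinear: "t \<ge> 0 \<Longrightarrow> bounded_clinear (T t)"
  using system by (simp add: linear_system_def bounded_c0_semigroup_def)

lemma T_0 [simp]: "T 0 v = v"
  using system by (simp add: linear_system_def bounded_c0_semigroup_def)

lemma T_add: "s \<ge> 0 \<Longrightarrow> t \<ge> 0 \<Longrightarrow> T (s + t) v = T s (T t v)"
  using system by (simp add: linear_system_def bounded_c0_semigroup_def)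

lemma T_continuous: "continuous_on {0..} (\<lambda>t. T t v)"
  using system by (simp add: linear_system_def bounded_c0_semigroup_def)

lemma B_eq: "B c = c *\<^sub>C B 1"
  using system bounded_clinear_scaleC[of B c 1] by (simp add: linear_system_def)

lemma C_clinear: "bounded_clinear C"
  using system by (simp add: linear_system_def)

lemma T_bounded: obtains M where "M > 0" "\<And>t v. t \<ge> 0 \<Longrightarrow> norm (T t v) \<le> M * norm v"
proof -
  obtain M where M: "\<And>t. t \<ge> 0 \<Longrightarrow> onorm (T t) \<le> M"
    using system by (auto simp: linear_system_def bounded_c0_semigroup_def)
  show ?thesis
  proof (rule that[of "max M 1"])
    fix t :: real and v assume t: "t \<ge> 0"
    have "norm (T t v) \<le> onorm (T t) * norm v" by (rule onorm_bound_clinear[OF T_clinear[OF t]])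
    also have "\<dots> \<le> max M 1 * norm v" using M[OF t] by (intro mult_right_mono) auto
    finally show "norm (T t v) \<le> max M 1 * norm v" .
  qed simp
qed

text \<open>One contraction suffices: write $t = nt_0 + r$ and use $\|T(t_0)\|^n$ together with the
  uniform bound on \<open>T r\<close>. The maximum with $1/2$ only keeps the logarithm defined.\<close>

lemma T_exp_decay:
  obtains M \<omega> where "M > 0" "\<omega> > 0" "\<And>t v. t \<ge> 0 \<Longrightarrow> norm (T t v) \<le> M * exp (- (\<omega> * t)) * norm v"
proof -
  obtain M where M: "M > 0" "\<And>t v. t \<ge> 0 \<Longrightarrow> norm (T t v) \<le> M * norm v" by (rule T_bounded) blast
  define q where "q = max (onorm (T t0)) (1/2)"
  have q: "0 < q" "q < 1" "onorm (T t0) \<le> q" using decay by (auto simp: q_def)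
  have power: "norm (T (real n * t0) v) \<le> q ^ n * norm v" for n v
  proof (induction n)
    case (Suc n)
    have "T (real (Suc n) * t0) v = T t0 (T (real n * t0) v)"
      using T_add[of t0 "real n * t0" v] decay(1) by (simp add: algebra_simps)
    also have "norm \<dots> \<le> onorm (T t0) * norm (T (real n * t0) v)"
      using decay(1) by (intro onorm_bound_clinear T_clinear) auto
    also have "\<dots> \<le> q * (q ^ n * norm v)"
      using q Suc by (intro mult_mono) auto
    finally show ?case by (simp add: mult_ac)
  qed simp
  show ?thesis
  proof (rule that[of "M / q" "- ln q / t0"])
    fix t :: real and v assume t: "t \<ge> 0"
    define n where "n = nat \<lfloor>t / t0\<rfloor>"
    have n: "real n * t0 \<le> t" "t / t0 \<le> real n + 1"
    proof -
      have "real n = of_int \<lfloor>t / t0\<rfloor>" using t decay(1) by (simp add: n_def)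
      then have "real n \<le> t / t0" "t / t0 \<le> real n + 1" by linarith+
      then show "real n * t0 \<le> t" "t / t0 \<le> real n + 1" using decay(1) by (simp_all add: field_simps)
    qed
    have "T t v = T (t - real n * t0) (T (real n * t0) v)"
      using T_add[of "t - real n * t0" "real n * t0" v] n(1) decay(1) by simp
    also have "norm \<dots> \<le> M * norm (T (real n * t0) v)"
      using n(1) by (intro M(2)) simp
    also have "\<dots> \<le> M * (q ^ n * norm v)"
      using M(1) by (intro mult_left_mono power) simp
    also have "q ^ n \<le> exp (- (- ln q / t0 * t)) / q"
    proof -
      have "real n * ln q \<le> (t / t0 - 1) * ln q"
        using q n(2) by (intro mult_right_mono_neg) auto
      then have "exp (real n * ln q) \<le> exp (ln q / t0 * t - ln q)"
        by (simp add: algebra_simps)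
      then show ?thesis using q by (simp add: exp_diff exp_of_nat_mult)
    qed
    finally show "norm (T t v) \<le> M / q * exp (- (- ln q / t0 * t)) * norm v"
      using M(1) by (simp add: mult_left_mono mult_right_mono mult_ac)
  qed (use M q decay in \<open>auto simp: divide_neg_pos\<close>)
qed

text \<open>Membership in the domain and the value of \<open>A\<close> are both obtained by exhibiting the limit of
  the difference quotients of the orbit.\<close>

lemma generator:
  assumes "((\<lambda>t. (T t v - v) /\<^sub>R t) \<longlongrightarrow> w) (at_right 0)"
  shows "v \<in> D" "A v = - w"
proof -
  have gen: "generates D (\<lambda>v. - A v) T" using system by (simp add: linear_system_def)
  then show v: "v \<in> D" using assms by (auto simp: generates_def)
  then have "((\<lambda>t. (T t v - v) /\<^sub>R t) \<longlongrightarrow> - A v) (at_right 0)"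
    using gen by (auto simp: generates_def)
  from tendsto_unique[OF _ this assms] show "A v = - w"
    by (metis minus_minus trivial_limit_at_right_real)
qed

lemma generator_limit:
  assumes "v \<in> D"
  shows "((\<lambda>t. (T t v - v) /\<^sub>R t) \<longlongrightarrow> - A v) (at_right 0)"
  using assms system by (auto simp: linear_system_def generates_def)

lemma A_add: 
  assumes "u \<in> D" "v \<in> D" shows "u + v \<in> D" "A (u + v) = A u + A v"
proof -
  have "((\<lambda>t. (T t u - u) /\<^sub>R t + (T t v - v) /\<^sub>R t) \<longlongrightarrow> - A u + - A v) (at_right 0)"
    by (intro tendsto_add generator_limit assms)
  moreover have "\<forall>\<^sub>F t in at_right 0. (T t u - u) /\<^sub>R t + (T t v - v) /\<^sub>R t = (T t (u + v) - (u + v)) /\<^sub>R t"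
    unfolding eventually_at_right_field
    by (intro exI[of _ 1]) (auto simp: bounded_clinear_add[OF T_clinear] algebra_simps)
  ultimately have "((\<lambda>t. (T t (u + v) - (u + v)) /\<^sub>R t) \<longlongrightarrow> - A u + - A v) (at_right 0)"
    by (rule Lim_transform_eventually)
  from generator[OF this] show "u + v \<in> D" "A (u + v) = A u + A v" by auto
qed

lemma A_scaleC:
  assumes "v \<in> D" shows "c *\<^sub>C v \<in> D" "A (c *\<^sub>C v) = c *\<^sub>C A v"
proof -
  have "((\<lambda>t. c *\<^sub>C ((T t v - v) /\<^sub>R t)) \<longlongrightarrow> c *\<^sub>C (- A v)) (at_right 0)"
    by (intro scaleC.tendsto tendsto_const generator_limit assms)
  moreover have "\<forall>\<^sub>F t in at_right 0. c *\<^sub>C ((T t v - v) /\<^sub>R t) = (T t (c *\<^sub>C v) - c *\<^sub>C v) /\<^sub>R t"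
    unfolding eventually_at_right_field
    by (intro exI[of _ 1])
       (auto simp: bounded_clinear_scaleC[OF T_clinear] scaleC.scaleR_right scaleC.diff_right)
  ultimately have "((\<lambda>t. (T t (c *\<^sub>C v) - c *\<^sub>C v) /\<^sub>R t) \<longlongrightarrow> c *\<^sub>C (- A v)) (at_right 0)"
    by (rule Lim_transform_eventually)
  from generator[OF this] show "c *\<^sub>C v \<in> D" "A (c *\<^sub>C v) = c *\<^sub>C A v" by (auto simp: scaleC.minus_right)
qed

text \<open>The smooth vectors of \<open>A\<close>. Outside its domain \<open>A\<close> has arbitrary values, so its powers
  are linear only on vectors of this kind.\<close>

definition Dinf :: "'h set" where "Dinf = {v. \<forall>j. (A ^^ j) v \<in> D}"

lemma Dinf_D: "v \<in> Dinf \<Longrightarrow> v \<in> D"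
  unfolding Dinf_def by (auto dest: spec[of _ 0])

lemma A_pow_in_Dinf: "v \<in> Dinf \<Longrightarrow> (A ^^ j) v \<in> Dinf"
  unfolding Dinf_def by (auto simp flip: funpow_add comp_apply[of "A ^^ _" "A ^^ _"])

lemma A_in_Dinf: "v \<in> Dinf \<Longrightarrow> A v \<in> Dinf"
  using A_pow_in_Dinf[of v 1] by simp

lemma A_pow_add: 
  assumes "u \<in> Dinf" "v \<in> Dinf" shows "(A ^^ j) (u + v) = (A ^^ j) u + (A ^^ j) v"
  using assms by (induction j) (auto simp: A_add(2) Dinf_def)

lemma A_pow_scaleC:
  assumes "v \<in> Dinf" shows "(A ^^ j) (c *\<^sub>C v) = c *\<^sub>C (A ^^ j) v"
  using assms by (induction j) (auto simp: A_scaleC(2) Dinf_def)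

lemma Dinf_add: "u \<in> Dinf \<Longrightarrow> v \<in> Dinf \<Longrightarrow> u + v \<in> Dinf"
  using A_pow_add A_add(1) by (auto simp: Dinf_def)

lemma Dinf_scaleC: "v \<in> Dinf \<Longrightarrow> c *\<^sub>C v \<in> Dinf"
  using A_pow_scaleC A_scaleC(1) by (auto simp: Dinf_def)

lemma Dinf_diff: "u \<in> Dinf \<Longrightarrow> v \<in> Dinf \<Longrightarrow> u - v \<in> Dinf"
  using Dinf_add[of u "- v"] Dinf_scaleC[of v "- 1"] by (simp add: scaleC.minus_left)

lemma A_pow_diff:
  assumes "u \<in> Dinf" "v \<in> Dinf" shows "(A ^^ j) (u - v) = (A ^^ j) u - (A ^^ j) v"
  using A_pow_add[OF assms(1) Dinf_scaleC[OF assms(2), of "- 1"]] A_pow_scaleC[OF assms(2), of j "- 1"]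
  by (simp add: scaleC.minus_left)

lemmas A_diff_Dinf = A_pow_diff[where j = 1, simplified]
lemmas A_add_Dinf = A_pow_add[where j = 1, simplified]
lemmas A_scaleC_Dinf = A_pow_scaleC[where j = 1, simplified]
lemmas Dinf_intros = Dinf_add Dinf_diff Dinf_scaleC A_in_Dinf A_pow_in_Dinf

section \<open>The holomorphic continuation of the semigroup\<close>

lemma E_holomorphic: "op_holomorphic_on E \<Omega>"
  and E_real: "t \<ge> 0 \<Longrightarrow> complex_of_real t \<in> \<Omega> \<Longrightarrow> E (complex_of_real t) = T t"
  and bij_resolvent: "z \<in> \<Omega> \<Longrightarrow> bij (\<lambda>v. v + sys_R E B C z v)"
  and F_holomorphic: "op_holomorphic_on (sys_F E B C) \<Omega>"
  using holomorphic by (auto simp: holomorphic_system_on_def)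

text \<open>\<open>EA j z\<close> is the operator $A^je^{-zA}$, see lemma \<open>A_pow_E\<close> below; it is introduced as
  $(-d/dz)^je^{-zA}$, which is bounded by construction.\<close>

definition EA :: "nat \<Rightarrow> complex \<Rightarrow> 'h \<Rightarrow> 'h" where
  "EA j = (neg_opderiv ^^ j) E"

lemma EA_0 [simp]: "EA 0 = E" by (simp add: EA_def)

lemma EA_holomorphic: "op_holomorphic_on (EA j) \<Omega>"
  unfolding EA_def
  by (induction j) (auto intro: E_holomorphic op_holomorphic_neg_opderiv domain)

lemma EA_clinear: "z \<in> \<Omega> \<Longrightarrow> bounded_clinear (EA j z)"
  using EA_holomorphic[of j] by (simp add: op_holomorphic_on_alt)

lemma E_clinear: "z \<in> \<Omega> \<Longrightarrow> bounded_clinear (E z)"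
  using EA_clinear[of z 0] by simp

lemma EA_opderiv: "z \<in> \<Omega> \<Longrightarrow> has_opderiv (EA j) (\<lambda>v. - EA (Suc j) z v) z"
  using EA_holomorphic[of j] unfolding op_holomorphic_on_alt
  by (auto simp: EA_def intro: has_opderiv_neg_opderiv)

lemma EA_product:
  assumes "z \<in> \<Omega>" "has_vderiv u d z"
  shows "has_vderiv (\<lambda>y. EA j y (u y)) (EA j z d - EA (Suc j) z (u z)) z"
  using has_opderiv_product[OF domain(1) assms(1) EA_clinear EA_opderiv[OF assms(1)] assms(2), of j]
  by simp

lemma E_product:
  assumes "z \<in> \<Omega>" "has_vderiv u d z"
  shows "has_vderiv (\<lambda>y. E y (u y)) (E z d - EA (Suc 0) z (u z)) z"
  using EA_product[OF assms, of 0] by simp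

lemma EA_vderiv: "z \<in> \<Omega> \<Longrightarrow> has_vderiv (\<lambda>y. EA j y v) (- EA (Suc j) z v) z"
  using EA_product[OF _ has_vderiv_const, of z j v] by (simp add: bounded_clinear_zero[OF EA_clinear])

text \<open>For real \<open>z\<close> this is the semigroup law; both sides are holomorphic in \<open>z\<close>.\<close>

lemma E_add:
  assumes z: "z \<in> \<Omega>" and t: "t \<ge> 0"
  shows "E (z + complex_of_real t) v = E z (T t v)"
    and "E (z + complex_of_real t) v = T t (E z v)"
proof -
  \<comment> \<open>\<open>E\<close> agrees with \<open>T\<close> only at nonnegative real points, hence the maximum\<close>
  have real: "E (complex_of_real s + complex_of_real t) v = T t (E (complex_of_real s) v)"
    "E (complex_of_real s + complex_of_real t) v = E (complex_of_real s) (T t v)"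
    "complex_of_real s \<in> \<Omega>"
    if "s > max r 0" for s
    using that t E_real[of s] E_real[of "s + t"] ray shift[OF ray[of s], of t] T_add[of s t v] T_add[of t s v]
    by (auto simp: add.commute)
  have d: "\<exists>d. has_vderiv (\<lambda>z. E (z + complex_of_real t) v) d y" if "y \<in> \<Omega>" for y
    using has_vderiv_shift[of "\<lambda>y. E y v"] EA_vderiv[of _ 0 v] shift[OF that t] by fastforce
  have d': "\<exists>d. has_vderiv (\<lambda>z. E z w) d y" if "y \<in> \<Omega>" for y w
    using EA_vderiv[OF that, of 0 w] by auto
  show "E (z + complex_of_real t) v = E z (T t v)"
    by (rule vector_identity_theorem[OF domain d d' _ z, where r = "max r 0"]) (use real in auto)
  show "E (z + complex_of_real t) v = T t (E z v)"
    by (rule vector_identity_theorem[OF domain d _ _ z, where r = "max r 0"])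
       (use real has_vderiv_bounded_clinear[OF T_clinear[OF t]] d' in blast)+
qed

text \<open>Obtained by differentiating lemma \<open>E_add\<close> repeatedly.\<close>

lemma EA_add:
  assumes "z \<in> \<Omega>" "t \<ge> 0"
  shows "EA j (z + complex_of_real t) v = T t (EA j z v)"
  using assms
proof (induction j arbitrary: z)
  case 0
  then show ?case using E_add(2) by simp
next
  case (Suc j)
  have 1: "has_vderiv (\<lambda>y. EA j (y + complex_of_real t) v) (- EA (Suc j) (z + complex_of_real t) v) z"
    using has_vderiv_shift[of "\<lambda>y. EA j y v"] EA_vderiv shift Suc.prems by blast
  have 2: "has_vderiv (\<lambda>y. T t (EA j y v)) (T t (- EA (Suc j) z v)) z"
    using has_vderiv_bounded_clinear[OF T_clinear EA_vderiv] Suc.prems by blast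
  have "has_vderiv (\<lambda>y. T t (EA j y v)) (- EA (Suc j) (z + complex_of_real t) v) z"
    by (rule has_vderiv_transform[OF 1 domain(1)]) (use Suc in auto)
  from has_vderiv_unique[OF this 2] show ?case
    using Suc.prems by (simp add: bounded_clinear_minus[OF T_clinear])
qed

text \<open>By lemma \<open>EA_add\<close> the orbit of \<open>EA j z v\<close> under the semigroup is a horizontal translate of
  the holomorphic function \<open>\<lambda>z. EA j z v\<close>, hence differentiable at time 0.\<close>

lemma
  assumes z: "z \<in> \<Omega>"
  shows EA_in_D: "EA j z v \<in> D" and A_EA: "A (EA j z v) = EA (Suc j) z v"
proof -
  have "((\<lambda>t. (EA j (z + complex_of_real t) v - EA j z v) /\<^sub>R t) \<longlongrightarrow> - EA (Suc j) z v) (at_right 0)"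
    using EA_vderiv[OF z] by (rule has_vderiv_right)
  moreover have "\<forall>\<^sub>F t in at_right 0. (EA j (z + complex_of_real t) v - EA j z v) /\<^sub>R t =
      (T t (EA j z v) - EA j z v) /\<^sub>R t"
    unfolding eventually_at_right_field using EA_add[OF z] by (intro exI[of _ 1]) auto
  ultimately have "((\<lambda>t. (T t (EA j z v) - EA j z v) /\<^sub>R t) \<longlongrightarrow> - EA (Suc j) z v) (at_right 0)"
    by (rule Lim_transform_eventually)
  from generator[OF this] show "EA j z v \<in> D" "A (EA j z v) = EA (Suc j) z v" by auto
qed

lemma A_pow_EA: "z \<in> \<Omega> \<Longrightarrow> (A ^^ i) (EA j z v) = EA (i + j) z v"
  by (induction i) (auto simp: A_EA)

lemma A_pow_E: "z \<in> \<Omega> \<Longrightarrow> (A ^^ i) (E z v) = EA i z v"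
  using A_pow_EA[of z i 0 v] by simp

lemma EA_in_Dinf: "z \<in> \<Omega> \<Longrightarrow> EA j z v \<in> Dinf"
  by (simp add: Dinf_def A_pow_EA EA_in_D)

lemma E_in_Dinf: "z \<in> \<Omega> \<Longrightarrow> E z v \<in> Dinf"
  using EA_in_Dinf[of z 0] by simp

lemma A_E: "z \<in> \<Omega> \<Longrightarrow> A (E z v) = EA (Suc 0) z v"
  using A_EA[of z 0] by simp

text \<open>Differentiate $E(z+t)v = E(z)T(t)v$ at $t = 0$.\<close>

lemma E_A:
  assumes z: "z \<in> \<Omega>" and v: "v \<in> D"
  shows "E z (A v) = EA (Suc 0) z v"
proof -
  have "((\<lambda>t. (E (z + complex_of_real t) v - E z v) /\<^sub>R t) \<longlongrightarrow> - EA (Suc 0) z v) (at_right 0)"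
    using has_vderiv_right[OF EA_vderiv[OF z, of 0 v]] by simp
  moreover have "((\<lambda>t. E z ((T t v - v) /\<^sub>R t)) \<longlongrightarrow> E z (- A v)) (at_right 0)"
    by (intro bounded_linear.tendsto[OF bounded_clinear_linear[OF E_clinear[OF z]]] generator_limit v)
  moreover have "\<forall>\<^sub>F t in at_right 0. E z ((T t v - v) /\<^sub>R t) = (E (z + complex_of_real t) v - E z v) /\<^sub>R t"
    unfolding eventually_at_right_field using E_add(1)[OF z]
    by (intro exI[of _ 1])
       (auto simp: linear_simps[OF bounded_clinear_linear[OF E_clinear[OF z]]])
  ultimately have "((\<lambda>t. (E (z + complex_of_real t) v - E z v) /\<^sub>R t) \<longlongrightarrow> E z (- A v)) (at_right 0)"
    "((\<lambda>t. (E (z + complex_of_real t) v - E z v) /\<^sub>R t) \<longlongrightarrow> - EA (Suc 0) z v) (at_right 0)"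
    by (auto intro: Lim_transform_eventually)
  from tendsto_unique[OF _ this] show ?thesis
    by (simp add: bounded_clinear_minus[OF E_clinear[OF z]])
qed

section \<open>The Lyapunov equation\<close>

definition gram_integrand :: "'h \<Rightarrow> real \<Rightarrow> 'h" where
  "gram_integrand v s = C (T s v) *\<^sub>C T s (B 1)"

text \<open>The Gramian $\int_0^\infty T(s)BCT(s)\,ds$. It would be $R_0$ if 0 were in the domain.\<close>

definition Gram :: "'h \<Rightarrow> 'h" where
  "Gram v = (LINT s:{0..}|lborel. gram_integrand v s)"

lemma gram_integrand_continuous: "continuous_on {0..} (gram_integrand v)"
  unfolding gram_integrand_def[abs_def]
  by (intro scaleC.continuous_on T_continuous bounded_linear.continuous_on[OF bounded_clinear_linear[OF C_clinear]])

lemma gram_integrand_bound: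
  obtains M \<omega> where "M \<ge> 0" "\<omega> > 0" "\<And>s v. s \<ge> 0 \<Longrightarrow> norm (gram_integrand v s) \<le> M * norm v * exp (- (\<omega> * s))"
proof -
  obtain M \<omega> where M: "M > 0" "\<omega> > 0" "\<And>t v. t \<ge> 0 \<Longrightarrow> norm (T t v) \<le> M * exp (- (\<omega> * t)) * norm v"
    by (rule T_exp_decay) blast
  have C: "0 \<le> onorm C" using C_clinear by (intro onorm_pos_le bounded_clinear_linear)
  show ?thesis
  proof (rule that[of "onorm C * M * (M * norm (B 1))" \<omega>])
    fix s :: real and v assume s: "s \<ge> 0"
    have "norm (gram_integrand v s) = cmod (C (T s v)) * norm (T s (B 1))"
      by (simp add: gram_integrand_def)
    also have "\<dots> \<le> (onorm C * (M * exp (- (\<omega> * s)) * norm v)) * (M * 1 * norm (B 1))"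
    proof (intro mult_mono)
      show "cmod (C (T s v)) \<le> onorm C * (M * exp (- (\<omega> * s)) * norm v)"
        using onorm_bound_clinear[OF C_clinear, of "T s v"] M(3)[OF s, of v] C
        by (meson mult_left_mono order_trans)
      have "exp (- (\<omega> * s)) \<le> 1" using M(2) s by simp
      then have "M * exp (- (\<omega> * s)) * norm (B 1) \<le> M * 1 * norm (B 1)"
        using M(1) by (intro mult_right_mono mult_left_mono) auto
      then show "norm (T s (B 1)) \<le> M * 1 * norm (B 1)"
        using M(3)[OF s, of "B 1"] by linarith
    qed (use M(1) C in auto)
    finally show "norm (gram_integrand v s) \<le> onorm C * M * (M * norm (B 1)) * norm v * exp (- (\<omega> * s))"
      by (simp add: mult_ac)
  qed (use M C in auto)
qed

lemma gram_integrand_integrable: "set_integrable lborel {0..} (gram_integrand v)"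
proof -
  obtain M \<omega> where M: "M \<ge> 0" "\<omega> > 0" "\<And>s v. s \<ge> 0 \<Longrightarrow> norm (gram_integrand v s) \<le> M * norm v * exp (- (\<omega> * s))"
    by (rule gram_integrand_bound) blast
  show ?thesis
  proof (rule set_integrable_bound)
    show "set_integrable lborel {0..} (\<lambda>s. M * norm v * exp (- (\<omega> * s)))"
      by (intro set_integrable_mult_right set_integrable_exp_decay M)
    show "set_borel_measurable lborel {0..} (gram_integrand v)"
      using set_measurable_continuous_on[OF _ gram_integrand_continuous[of v]]
      by (simp add: set_borel_measurable_def)
    show "AE s in lborel. s \<in> {0..} \<longrightarrow> norm (gram_integrand v s) \<le> norm (M * norm v * exp (- (\<omega> * s)))"
      using M by (intro AE_I2) auto
  qed
qed

lemma Gram_clinear: "bounded_clinear Gram"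
proof -
  obtain M \<omega> where M: "M \<ge> 0" "\<omega> > 0" "\<And>s v. s \<ge> 0 \<Longrightarrow> norm (gram_integrand v s) \<le> M * norm v * exp (- (\<omega> * s))"
    by (rule gram_integrand_bound) blast
  show ?thesis
  proof (rule bounded_clinearI)
    fix u v
    have "Gram (u + v) = (LINT s:{0..}|lborel. gram_integrand u s + gram_integrand v s)"
      unfolding Gram_def
      by (intro set_lebesgue_integral_cong)
         (auto simp: gram_integrand_def bounded_clinear_add[OF T_clinear] bounded_clinear_add[OF C_clinear] scaleC.add_left)
    then show "Gram (u + v) = Gram u + Gram v"
      using set_integral_add(2)[OF gram_integrand_integrable gram_integrand_integrable] by (simp add: Gram_def)
  next
    fix c v
    have "Gram (c *\<^sub>C v) = (LINT s:{0..}|lborel. c *\<^sub>C gram_integrand v s)"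
      unfolding Gram_def
      by (intro set_lebesgue_integral_cong)
         (auto simp: gram_integrand_def bounded_clinear_scaleC[OF T_clinear] bounded_clinear_scaleC[OF C_clinear]
            scaleC_scaleC)
    then show "Gram (c *\<^sub>C v) = c *\<^sub>C Gram v"
      using set_integral_bounded_linear[OF scaleC.bounded_linear_right gram_integrand_integrable]
      by (simp add: Gram_def)
  next
    fix v
    define J where "J = (LINT s:{0..}|lborel. exp (- (\<omega> * s)))"
    have "norm (Gram v) \<le> (LINT s:{0..}|lborel. M * norm v * exp (- (\<omega> * s)))"
      unfolding Gram_def set_lebesgue_integral_def
    proof (rule Bochner_Integration.integral_norm_bound_integral)
      show "integrable lborel (\<lambda>s. indicator {0..} s *\<^sub>R gram_integrand v s)"
        using gram_integrand_integrable by (simp add: set_integrable_def)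
      have "set_integrable lborel {0..} (\<lambda>s. M * norm v * exp (- (\<omega> * s)))"
        by (intro set_integrable_mult_right set_integrable_exp_decay M)
      then show "integrable lborel (\<lambda>s. indicator {0..} s *\<^sub>R (M * norm v * exp (- (\<omega> * s))))"
        by (simp only: set_integrable_def)
      show "norm (indicator {0..} s *\<^sub>R gram_integrand v s) \<le> indicator {0..} s *\<^sub>R (M * norm v * exp (- (\<omega> * s)))" for s
        using M(3)[of s v] by (auto simp: indicator_def)
    qed
    then show "norm (Gram v) \<le> norm v * (M * J)" by (simp add: J_def mult_ac)
  qed
qed

text \<open>Both factors $E(z+s)$ in the integrand split off a factor \<open>E z\<close>, one to the left and one to
  the right, and \<open>E z\<close> is bounded. All dependence on \<open>z\<close> is then outside the integral, and the
  range of $R_z$ lies in that of \<open>E z\<close>.\<close>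

lemma R_eq:
  assumes z: "z \<in> \<Omega>"
  shows "sys_R E B C z v = E z (Gram (E z v))"
proof -
  have "E (z + complex_of_real s) (B (C (E (z + complex_of_real s) v))) = E z (gram_integrand (E z v) s)"
    if "s \<ge> 0" for s
  proof -
    have "E (z + complex_of_real s) (B (C (E (z + complex_of_real s) v))) = E z (T s (B (C (T s (E z v)))))"
      using E_add(1)[OF z that] E_add(2)[OF z that, of v] by simp
    also have "\<dots> = E z (gram_integrand (E z v) s)"
      unfolding gram_integrand_def by (subst B_eq) (simp add: bounded_clinear_scaleC[OF T_clinear[OF that]])
    finally show ?thesis .
  qed
  then have "sys_R E B C z v = (LINT s:{0..}|lborel. E z (gram_integrand (E z v) s))"
    unfolding sys_R_def by (intro set_lebesgue_integral_cong) auto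
  also have "\<dots> = E z (Gram (E z v))"
    unfolding Gram_def
    by (intro set_integral_bounded_linear bounded_clinear_linear E_clinear z gram_integrand_integrable)
  finally show ?thesis .
qed

text \<open>The substitution $s \mapsto s + h$ in the Gramian.\<close>

lemma Gram_shift:
  assumes h: "h > 0"
  shows "T h (Gram (T h v)) = Gram v - (LINT s:{0..<h}|lborel. gram_integrand v s)"
proof -
  have "T h (Gram (T h v)) = (LINT s:{0..}|lborel. T h (gram_integrand (T h v) s))"
    unfolding Gram_def using h
    by (intro set_integral_bounded_linear[symmetric] bounded_clinear_linear T_clinear gram_integrand_integrable) auto
  also have "\<dots> = (LINT s:{0..}|lborel. gram_integrand v (h + s))"
  proof (intro set_lebesgue_integral_cong allI impI)
    fix s :: real assume "s \<in> {0..}"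
    then have s: "s \<ge> 0" by simp
    have "T h (gram_integrand (T h v) s) = C (T s (T h v)) *\<^sub>C T h (T s (B 1))"
      using h by (simp add: gram_integrand_def bounded_clinear_scaleC[OF T_clinear])
    also have "T s (T h v) = T (h + s) v" using T_add[of s h v] s h by (simp add: add.commute)
    also have "T h (T s (B 1)) = T (h + s) (B 1)" using T_add[of h s "B 1"] s h by simp
    finally show "T h (gram_integrand (T h v) s) = gram_integrand v (h + s)" by (simp add: gram_integrand_def)
  qed auto
  also have "\<dots> = (LINT s:{h..}|lborel. gram_integrand v s)"
    unfolding set_lebesgue_integral_def
    by (subst (2) lborel_integral_real_affine[where c = 1 and t = h])
       (auto intro!: Bochner_Integration.integral_cong simp: indicator_def)
  finally have 1: "T h (Gram (T h v)) = (LINT s:{h..}|lborel. gram_integrand v s)" .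
  have "Gram v = (LINT s:{0..<h} \<union> {h..}|lborel. gram_integrand v s)"
    unfolding Gram_def using h by (intro arg_cong[where f = "\<lambda>S. set_lebesgue_integral lborel S (gram_integrand v)"]) auto
  also have "\<dots> = (LINT s:{0..<h}|lborel. gram_integrand v s) + (LINT s:{h..}|lborel. gram_integrand v s)"
    using h by (intro set_integral_Un set_integrable_subset[OF gram_integrand_integrable]) auto
  finally show ?thesis using 1 by simp
qed

lemma R_vderiv:
  assumes "z \<in> \<Omega>"
  shows "has_vderiv (\<lambda>y. E y (Gram (E y v))) (- E z (Gram (EA (Suc 0) z v)) - EA (Suc 0) z (Gram (E z v))) z"
  using E_product[OF assms has_vderiv_bounded_clinear[OF Gram_clinear EA_vderiv[OF assms, of 0 v]]]
  by (simp add: bounded_clinear_minus[OF Gram_clinear] bounded_clinear_minus[OF E_clinear[OF assms]])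

text \<open>Minus the derivative of $R_z = E(z)GE(z)$, computed by the product rule on the left and from
  lemma \<open>Gram_shift\<close> on the right. On the domain of \<open>A\<close> the left-hand side is $RA + AR$.\<close>

lemma Lyapunov:
  assumes z: "z \<in> \<Omega>"
  shows "E z (Gram (EA (Suc 0) z v)) + EA (Suc 0) z (Gram (E z v)) = C (E z v) *\<^sub>C E z (B 1)"
proof -
  define R where "R y = E y (Gram (E y v))" for y
  note linear = bounded_clinear_linear[OF E_clinear[OF z]]
  have 1: "((\<lambda>t. (R (z + complex_of_real t) - R z) /\<^sub>R t) \<longlongrightarrow>
      - E z (Gram (EA (Suc 0) z v)) - EA (Suc 0) z (Gram (E z v))) (at_right 0)"
    using has_vderiv_right[OF R_vderiv[OF z]] by (simp add: R_def)
  have "((\<lambda>t. - E z ((LINT s:{0..<t}|lborel. gram_integrand (E z v) s) /\<^sub>R t)) \<longlongrightarrow> - E z (gram_integrand (E z v) 0)) (at_right 0)"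
    by (intro tendsto_minus bounded_linear.tendsto[OF linear] set_integral_initial_average gram_integrand_continuous)
  moreover have "\<forall>\<^sub>F t in at_right 0. - E z ((LINT s:{0..<t}|lborel. gram_integrand (E z v) s) /\<^sub>R t) =
      (R (z + complex_of_real t) - R z) /\<^sub>R t"
    unfolding eventually_at_right_field
  proof (intro exI[of _ 1] conjI allI impI)
    fix t :: real assume t: "0 < t"
    have "R (z + complex_of_real t) = E z (T t (Gram (T t (E z v))))"
      using t E_add(1)[OF z, of t] E_add(2)[OF z, of t v] by (simp add: R_def)
    then have "R (z + complex_of_real t) - R z = - E z (LINT s:{0..<t}|lborel. gram_integrand (E z v) s)"
      by (simp add: Gram_shift[OF t] R_def linear_simps[OF linear])
    then show "- E z ((LINT s:{0..<t}|lborel. gram_integrand (E z v) s) /\<^sub>R t) = (R (z + complex_of_real t) - R z) /\<^sub>R t"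
      by (simp add: linear_simps[OF linear])
  qed simp
  ultimately have "((\<lambda>t. (R (z + complex_of_real t) - R z) /\<^sub>R t) \<longlongrightarrow> - E z (gram_integrand (E z v) 0)) (at_right 0)"
    by (rule Lim_transform_eventually)
  from tendsto_unique[OF _ this 1]
  have "E z (gram_integrand (E z v) 0) = E z (Gram (EA (Suc 0) z v)) + EA (Suc 0) z (Gram (E z v))"
    by (simp add: algebra_simps)
  then show ?thesis
    by (simp add: gram_integrand_def bounded_clinear_scaleC[OF E_clinear[OF z]])
qed

section \<open>The algebra of the resolvent\<close>

definition F :: "complex \<Rightarrow> 'h \<Rightarrow> 'h" where "F = sys_F E B C"

text \<open>The vector \<open>w\<close> and the functional $\ell$ through which the bracket is expressed:
  $\lfloor P\rfloor = \ell(Pw)$.\<close>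

definition wvec :: "complex \<Rightarrow> 'h" where "wvec z = F z (E z (B 1))"

definition lfun :: "complex \<Rightarrow> 'h \<Rightarrow> complex" where "lfun z v = C (E z (F z v))"

text \<open>The Cayley transform $I - 2F = (R - I)(R + I)^{-1}$. Multiplying \<open>A\<close> by it on both sides
  changes \<open>A\<close> only by a rank one operator.\<close>

definition J :: "complex \<Rightarrow> 'h \<Rightarrow> 'h" where "J z v = v - 2 *\<^sub>C F z v"

lemma F_clinear: "z \<in> \<Omega> \<Longrightarrow> bounded_clinear (F z)"
  using F_holomorphic by (simp add: op_holomorphic_on_alt F_def)

lemma lfun_clinear: "z \<in> \<Omega> \<Longrightarrow> bounded_clinear (lfun z)"
  unfolding lfun_def[abs_def]
  by (rule bounded_clinear_compose[OF C_clinear bounded_clinear_compose[OF E_clinear F_clinear]])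

lemma J_clinear:
  assumes z: "z \<in> \<Omega>"
  shows "bounded_clinear (J z)"
proof -
  have "bounded_clinear (\<lambda>v. v :: 'h)"
    by (rule bounded_clinearI[of _ 1]) auto
  then show ?thesis
    unfolding J_def[abs_def]
    by (rule bounded_clinear_sub[OF _ bounded_clinear_scaleC_compose[OF F_clinear[OF z]]])
qed

lemma F_left:
  assumes z: "z \<in> \<Omega>"
  shows "F z (v + E z (Gram (E z v))) = v"
  using inv_f_f[OF bij_is_inj[OF bij_resolvent[OF z]], of v] by (simp add: F_def sys_F_def R_eq[OF z])

lemma F_right:
  assumes z: "z \<in> \<Omega>"
  shows "F z v + E z (Gram (E z (F z v))) = v"
  using surj_f_inv_f[OF bij_is_surj[OF bij_resolvent[OF z]], of v] by (simp add: F_def sys_F_def R_eq[OF z])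

text \<open>Applying \<open>F\<close> changes a vector only by an element of the range of \<open>E z\<close>, hence by a smooth
  vector.\<close>

lemma F_expand: "z \<in> \<Omega> \<Longrightarrow> F z v = v - E z (Gram (E z (F z v)))"
  using F_right[of z v] by (simp add: eq_diff_eq)

lemma F_in_Dinf: "z \<in> \<Omega> \<Longrightarrow> v \<in> Dinf \<Longrightarrow> F z v \<in> Dinf"
  by (subst F_expand) (auto intro: Dinf_diff E_in_Dinf)

lemma J_in_Dinf: "z \<in> \<Omega> \<Longrightarrow> v \<in> Dinf \<Longrightarrow> J z v \<in> Dinf"
  unfolding J_def by (intro Dinf_intros F_in_Dinf)

lemma wvec_in_Dinf: "z \<in> \<Omega> \<Longrightarrow> wvec z \<in> Dinf"
  unfolding wvec_def by (intro F_in_Dinf E_in_Dinf)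

text \<open>The usual $F' = -FR'F$. The derivative is known to exist, so it suffices to differentiate
  $(I + R)Fv = v$ and to insert $R' = -(Eb)(CE)$ from the Lyapunov equation.\<close>

lemma F_opderiv:
  assumes z: "z \<in> \<Omega>"
  shows "has_opderiv F (\<lambda>v. lfun z v *\<^sub>C wvec z) z"
proof -
  obtain G where G: "has_opderiv F G z"
    using F_holomorphic z by (auto simp: op_holomorphic_on_alt F_def)
  have "G v = lfun z v *\<^sub>C wvec z" for v
  proof -
    define u where "u y = F y v" for y
    have u: "has_vderiv u (G v) z"
      unfolding u_def[abs_def] by (rule has_opderiv_vderiv[OF domain(1) z F_clinear G])
    have "has_vderiv (\<lambda>y. u y + E y (Gram (E y (u y))))
        (G v + (E z (Gram (E z (G v) - EA (Suc 0) z (u z))) - EA (Suc 0) z (Gram (E z (u z))))) z"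
      by (intro has_vderiv_add u E_product z has_vderiv_bounded_clinear[OF Gram_clinear])
    then have "has_vderiv (\<lambda>y. v)
        (G v + (E z (Gram (E z (G v) - EA (Suc 0) z (u z))) - EA (Suc 0) z (Gram (E z (u z))))) z"
      by (rule has_vderiv_transform[OF _ domain(1) z]) (simp add: u_def F_right)
    from has_vderiv_unique[OF this has_vderiv_const]
    have "G v + E z (Gram (E z (G v))) = E z (Gram (EA (Suc 0) z (u z))) + EA (Suc 0) z (Gram (E z (u z)))"
      by (simp add: bounded_clinear_diff[OF Gram_clinear] bounded_clinear_diff[OF E_clinear[OF z]] algebra_simps)
    then have "G v + E z (Gram (E z (G v))) = lfun z v *\<^sub>C E z (B 1)"
      by (simp add: Lyapunov[OF z] lfun_def u_def)
    then have "G v = F z (lfun z v *\<^sub>C E z (B 1))"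
      using F_left[OF z, of "G v"] by simp
    then show ?thesis by (simp add: bounded_clinear_scaleC[OF F_clinear[OF z]] wvec_def)
  qed
  then have "G = (\<lambda>v. lfun z v *\<^sub>C wvec z)" by auto
  then show ?thesis using G by simp
qed

lemma F_product:
  assumes "z \<in> \<Omega>" "has_vderiv u d z"
  shows "has_vderiv (\<lambda>y. F y (u y)) (lfun z (u z) *\<^sub>C wvec z + F z d) z"
  using has_opderiv_product[OF domain(1) assms(1) F_clinear F_opderiv[OF assms(1)] assms(2)] .

lemma two_scaleC: "2 *\<^sub>C v = v + (v :: 'h)"
  using scaleC_add_left[of 1 1 v] by simp

text \<open>The Lyapunov equation in the form $A(I+R) + (I+R)A = 2A + (Eb)(CE)$, multiplied by \<open>F\<close> on
  both sides. It is evaluated at $u = (I+R)q$ with $q = Fu$.\<close>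

lemma commutator:
  assumes z: "z \<in> \<Omega>" and u: "u \<in> Dinf"
  shows "A (F z u) + F z (A u) = 2 *\<^sub>C F z (A (F z u)) + lfun z u *\<^sub>C wvec z"
proof -
  define q where "q = F z u"
  \<comment> \<open>\<open>r\<close> is $(I + R)Aq$, so \<open>F\<close> takes it back to $Aq$\<close>
  define r where "r = A q + E z (Gram (E z (A q)))"
  have q: "q \<in> Dinf" using z u by (simp add: q_def F_in_Dinf)
  have "u = q + E z (Gram (E z q))" using F_right[OF z, of u] by (simp add: q_def)
  then have Au: "A u = A q + EA (Suc 0) z (Gram (E z q))"
    using A_add_Dinf[OF q E_in_Dinf[OF z]] by (simp add: A_E[OF z])
  have "E z (Gram (E z (A q))) + EA (Suc 0) z (Gram (E z q)) = lfun z u *\<^sub>C E z (B 1)"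
    using Lyapunov[OF z, of q] by (simp add: E_A[OF z Dinf_D[OF q]] lfun_def flip: q_def)
  then have "A u = 2 *\<^sub>C A q - r + lfun z u *\<^sub>C E z (B 1)"
    by (simp add: Au r_def two_scaleC algebra_simps)
  moreover have "F z r = A q" unfolding r_def by (rule F_left[OF z])
  ultimately have "F z (A u) = 2 *\<^sub>C F z (A q) - A q + lfun z u *\<^sub>C wvec z"
    by (simp add: bounded_clinear_simps[OF F_clinear[OF z]] wvec_def)
  then show ?thesis by (simp add: q_def)
qed

text \<open>Expand $JAJ = A - 2(AF + FA) + 4FAF$ and insert the commutator relation.\<close>

lemma J_A_J:
  assumes z: "z \<in> \<Omega>" and u: "u \<in> Dinf"
  shows "J z (A (J z u)) = A u - 2 *\<^sub>C (lfun z u *\<^sub>C wvec z)"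
proof -
  have AJ: "A (J z u) = A u - 2 *\<^sub>C A (F z u)"
    unfolding J_def using u z
    by (simp add: A_diff_Dinf A_scaleC_Dinf Dinf_scaleC F_in_Dinf)
  have "J z (A (J z u)) = A u - 2 *\<^sub>C (A (F z u) + F z (A u)) + 2 *\<^sub>C (2 *\<^sub>C F z (A (F z u)))"
    unfolding AJ by (simp add: J_def bounded_clinear_simps[OF F_clinear[OF z]] two_scaleC algebra_simps)
  then show ?thesis
    by (simp add: commutator[OF z u] scaleC_add_right)
qed

text \<open>The right-hand side is what the product rule gives for the derivative of $\ell$; so
  $\ell' = \ell AJ$ on smooth vectors.\<close>

lemma lfun_A_J:
  assumes z: "z \<in> \<Omega>" and u: "u \<in> Dinf"
  shows "lfun z (A (J z u)) = lfun z u * C (E z (wvec z)) - C (EA (Suc 0) z (F z u))"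
proof -
  have Fu: "F z u \<in> Dinf" by (rule F_in_Dinf[OF z u])
  have "C (E z (A (F z u) + F z (A u))) = C (E z (2 *\<^sub>C F z (A (F z u)) + lfun z u *\<^sub>C wvec z))"
    by (simp only: commutator[OF z u])
  then have "C (EA (Suc 0) z (F z u)) + lfun z (A u) = 2 * lfun z (A (F z u)) + lfun z u * C (E z (wvec z))"
    by (simp add: bounded_clinear_simps[OF C_clinear] bounded_clinear_simps[OF E_clinear[OF z]]
        E_A[OF z Dinf_D[OF Fu]] lfun_def)
  moreover have "lfun z (A (J z u)) = lfun z (A u) - 2 * lfun z (A (F z u))"
    unfolding J_def using u z Fu
    by (simp add: A_diff_Dinf A_scaleC_Dinf Dinf_scaleC bounded_clinear_simps[OF lfun_clinear])
  ultimately show ?thesis by algebra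
qed

section \<open>Differentiating words\<close>

text \<open>A differentiable family of smooth vectors for which every power of \<open>A\<close> commutes with the
  derivative. As \<open>A\<close> is unbounded this does not follow from differentiability alone, so it is
  carried along through all constructions.\<close>

definition smooth :: "(complex \<Rightarrow> 'h) \<Rightarrow> (complex \<Rightarrow> 'h) \<Rightarrow> bool" where
  "smooth u u' \<longleftrightarrow> (\<forall>z\<in>\<Omega>. u z \<in> Dinf \<and> u' z \<in> Dinf \<and>
     (\<forall>j. has_vderiv (\<lambda>y. (A ^^ j) (u y)) ((A ^^ j) (u' z)) z))"

lemma smoothD:
  assumes "smooth u u'" "z \<in> \<Omega>"
  shows "u z \<in> Dinf" "u' z \<in> Dinf" "has_vderiv (\<lambda>y. (A ^^ j) (u y)) ((A ^^ j) (u' z)) z"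
    "has_vderiv u (u' z) z"
proof -
  show *: "u z \<in> Dinf" "u' z \<in> Dinf" "has_vderiv (\<lambda>y. (A ^^ j) (u y)) ((A ^^ j) (u' z)) z" for j
    using assms by (auto simp: smooth_def)
  show "has_vderiv u (u' z) z" using *(3)[of 0] by simp
qed

lemma smooth_A_pow:
  assumes "smooth u u'"
  shows "smooth (\<lambda>z. (A ^^ k) (u z)) (\<lambda>z. (A ^^ k) (u' z))"
  unfolding smooth_def
proof (intro ballI conjI allI)
  fix z j assume z: "z \<in> \<Omega>"
  show "(A ^^ k) (u z) \<in> Dinf" "(A ^^ k) (u' z) \<in> Dinf"
    using smoothD[OF assms z] by (auto intro: A_pow_in_Dinf)
  show "has_vderiv (\<lambda>y. (A ^^ j) ((A ^^ k) (u y))) ((A ^^ j) ((A ^^ k) (u' z))) z"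
    using smoothD(3)[OF assms z, of "j + k"] by (simp add: funpow_add)
qed

lemma smooth_A: "smooth u u' \<Longrightarrow> smooth (\<lambda>z. A (u z)) (\<lambda>z. A (u' z))"
  using smooth_A_pow[of u u' 1] by simp

text \<open>In $Fu = u - Ep$ with $p = GEFu$, the vector \<open>p\<close> is differentiable without any reference to
  \<open>A\<close>, and $A^jEp$ is a product of the holomorphic operator family $A^jE$ with \<open>p\<close>. Comparison with
  lemma \<open>F_product\<close> for $j = 0$ identifies the derivative.\<close>

lemma smooth_F:
  assumes u: "smooth u u'"
  shows "smooth (\<lambda>z. F z (u z)) (\<lambda>z. lfun z (u z) *\<^sub>C wvec z + F z (u' z))"
  unfolding smooth_def
proof (intro ballI conjI allI)
  fix z assume z: "z \<in> \<Omega>"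
  note uz = smoothD[OF u z]
  define q where "q y = F y (u y)" for y
  define q' where "q' = lfun z (u z) *\<^sub>C wvec z + F z (u' z)"
  define p where "p y = Gram (E y (q y))" for y
  define p' where "p' = Gram (E z q' - EA (Suc 0) z (q z))"
  show "F z (u z) \<in> Dinf" "q' \<in> Dinf"
    unfolding q'_def using z uz by (auto intro: F_in_Dinf Dinf_add Dinf_scaleC wvec_in_Dinf)
  have q: "has_vderiv q q' z"
    unfolding q_def[abs_def] q'_def by (rule F_product[OF z uz(4)])
  have p: "has_vderiv p p' z"
    unfolding p_def[abs_def] p'_def by (intro has_vderiv_bounded_clinear[OF Gram_clinear] E_product z q)
  have deriv: "has_vderiv (\<lambda>y. (A ^^ j) (q y)) ((A ^^ j) (u' z) - (EA j z p' - EA (Suc j) z (p z))) z" for j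
  proof (rule has_vderiv_transform[OF _ domain(1) z])
    show "has_vderiv (\<lambda>y. (A ^^ j) (u y) - EA j y (p y)) ((A ^^ j) (u' z) - (EA j z p' - EA (Suc j) z (p z))) z"
      by (intro has_vderiv_diff uz EA_product z p)
    show "(A ^^ j) (u y) - EA j y (p y) = (A ^^ j) (q y)" if y: "y \<in> \<Omega>" for y
    proof -
      have "q y = u y - E y (p y)" using F_expand[OF y, of "u y"] by (simp add: q_def p_def)
      then show ?thesis
        by (simp add: A_pow_diff[OF smoothD(1)[OF u y] E_in_Dinf[OF y]] A_pow_E[OF y])
    qed
  qed
  have "q' = u' z - (E z p' - EA (Suc 0) z (p z))"
    using has_vderiv_unique[OF q] deriv[of 0] by simp
  then have "(A ^^ j) q' = (A ^^ j) (u' z) - (EA j z p' - EA (Suc j) z (p z))" for j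
    using A_pow_EA[OF z, of j "Suc 0"]
    by (simp add: A_pow_diff uz E_in_Dinf EA_in_Dinf Dinf_diff z A_pow_E)
  with deriv show "has_vderiv (\<lambda>y. (A ^^ j) (F y (u y))) ((A ^^ j) q') z" for j
    by (simp add: q_def)
qed

lemma smooth_J:
  assumes u: "smooth u u'"
  shows "smooth (\<lambda>z. J z (u z)) (\<lambda>z. J z (u' z) - 2 *\<^sub>C (lfun z (u z) *\<^sub>C wvec z))"
  unfolding smooth_def
proof (intro ballI conjI allI)
  fix z j assume z: "z \<in> \<Omega>"
  note uz = smoothD[OF u z] and Fz = smoothD[OF smooth_F[OF u] z]
  show "J z (u z) \<in> Dinf" "J z (u' z) - 2 *\<^sub>C (lfun z (u z) *\<^sub>C wvec z) \<in> Dinf"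
    using z uz by (auto intro!: J_in_Dinf Dinf_diff Dinf_scaleC wvec_in_Dinf)
  have deriv: "has_vderiv (\<lambda>y. (A ^^ j) (u y) - 2 *\<^sub>C (A ^^ j) (F y (u y)))
      ((A ^^ j) (u' z) - 2 *\<^sub>C (A ^^ j) (lfun z (u z) *\<^sub>C wvec z + F z (u' z))) z"
  proof (intro has_vderiv_diff uz)
    have "bounded_clinear (\<lambda>v :: 'h. 2 *\<^sub>C v)"
      by (rule bounded_clinearI[of _ 2]) (auto simp: scaleC_add_right scaleC_scaleC mult.commute)
    from has_vderiv_bounded_clinear[OF this Fz(3)]
    show "has_vderiv (\<lambda>y. 2 *\<^sub>C (A ^^ j) (F y (u y))) (2 *\<^sub>C (A ^^ j) (lfun z (u z) *\<^sub>C wvec z + F z (u' z))) z" .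
  qed
  have val: "(A ^^ j) (u' z) - 2 *\<^sub>C (A ^^ j) (lfun z (u z) *\<^sub>C wvec z + F z (u' z)) =
      (A ^^ j) (J z (u' z) - 2 *\<^sub>C (lfun z (u z) *\<^sub>C wvec z))"
  proof -
    have "J z (u' z) - 2 *\<^sub>C (lfun z (u z) *\<^sub>C wvec z) = u' z - 2 *\<^sub>C (lfun z (u z) *\<^sub>C wvec z + F z (u' z))"
      by (simp add: J_def scaleC_add_right)
    then show ?thesis
      by (simp only: A_pow_diff[OF uz(2) Dinf_scaleC[OF Fz(2)]] A_pow_scaleC[OF Fz(2)])
  qed
  have eq: "(A ^^ j) (u y) - 2 *\<^sub>C (A ^^ j) (F y (u y)) = (A ^^ j) (J y (u y))" if "y \<in> \<Omega>" for y
  proof -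
    have "u y \<in> Dinf" "F y (u y) \<in> Dinf" using smoothD(1)[OF u that] that by (auto intro: F_in_Dinf)
    then show ?thesis unfolding J_def by (simp only: A_pow_diff Dinf_scaleC A_pow_scaleC)
  qed
  show "has_vderiv (\<lambda>y. (A ^^ j) (J y (u y))) ((A ^^ j) (J z (u' z) - 2 *\<^sub>C (lfun z (u z) *\<^sub>C wvec z))) z"
    by (rule has_vderiv_transform[OF deriv[unfolded val] domain(1) z eq])
qed

lemma smooth_E: "smooth (\<lambda>z. E z v) (\<lambda>z. - EA (Suc 0) z v)"
proof -
  have "(A ^^ j) (- EA (Suc 0) z v) = - EA (Suc j) z v" if z: "z \<in> \<Omega>" for z j
    using A_pow_scaleC[OF EA_in_Dinf[OF z], of j "- 1" "Suc 0" v] A_pow_EA[OF z, of j "Suc 0" v]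
    by (simp add: scaleC.minus_left)
  moreover have "has_vderiv (\<lambda>y. (A ^^ j) (E y v)) (- EA (Suc j) z v) z" if "z \<in> \<Omega>" for z j
    by (rule has_vderiv_transform[OF EA_vderiv[OF that] domain(1) that]) (simp add: A_pow_E)
  moreover have "- EA (Suc 0) z v \<in> Dinf" if z: "z \<in> \<Omega>" for z
    using Dinf_scaleC[OF EA_in_Dinf[OF z], of "- 1" "Suc 0" v] by (simp add: scaleC.minus_left)
  ultimately show ?thesis
    by (simp add: smooth_def E_in_Dinf)
qed

lemma smooth_cong:
  assumes "smooth u u'" "\<And>z. z \<in> \<Omega> \<Longrightarrow> u' z = v' z"
  shows "smooth u v'"
  using assms by (simp add: smooth_def)

text \<open>From $w' = \ell(Eb)w - FAEb$; the commutator relation for $Eb$ removes the term with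
  $\ell(Eb)$.\<close>

lemma smooth_wvec: "smooth wvec (\<lambda>z. J z (A (wvec z)))"
proof -
  have "smooth (\<lambda>z. F z (E z (B 1))) (\<lambda>z. J z (A (wvec z)))"
  proof (rule smooth_cong[OF smooth_F[OF smooth_E]])
    fix z assume z: "z \<in> \<Omega>"
    have "A (wvec z) + F z (EA (Suc 0) z (B 1)) = 2 *\<^sub>C F z (A (wvec z)) + lfun z (E z (B 1)) *\<^sub>C wvec z"
      using commutator[OF z E_in_Dinf[OF z, of "B 1"]] by (simp add: A_E[OF z] wvec_def)
    then show "lfun z (E z (B 1)) *\<^sub>C wvec z + F z (- EA (Suc 0) z (B 1)) = J z (A (wvec z))"
      by (simp add: J_def bounded_clinear_minus[OF F_clinear[OF z]] algebra_simps)
  qed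
  then show ?thesis by (simp add: wvec_def[abs_def])
qed

text \<open>The product rule $(\ell u)' = \ell' u + \ell u'$, with $\ell' = \ell AJ$.\<close>

lemma lfun_smooth_deriv:
  assumes u: "smooth u u'" and z: "z \<in> \<Omega>"
  shows "((\<lambda>y. lfun y (u y)) has_field_derivative lfun z (A (J z (u z))) + lfun z (u' z)) (at z)"
proof -
  note uz = smoothD[OF u z]
  have "has_vderiv (\<lambda>y. C (E y (F y (u y))))
      (C (E z (lfun z (u z) *\<^sub>C wvec z + F z (u' z)) - EA (Suc 0) z (F z (u z)))) z"
    by (intro has_vderiv_bounded_clinear[OF C_clinear] E_product z F_product uz)
  moreover have "C (E z (lfun z (u z) *\<^sub>C wvec z + F z (u' z)) - EA (Suc 0) z (F z (u z))) =
      lfun z (A (J z (u z))) + lfun z (u' z)"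
    by (simp add: lfun_A_J[OF z uz(1)] bounded_clinear_simps[OF C_clinear]
        bounded_clinear_simps[OF E_clinear[OF z]]) (simp add: lfun_def)
  ultimately show ?thesis
    by (simp add: has_vderiv_field lfun_def)
qed

section \<open>The recursion\<close>

definition power_bracket :: "nat \<Rightarrow> complex \<Rightarrow> complex" where "power_bracket k z = lfun z ((A ^^ k) (wvec z))"

definition power_bracket' :: "nat \<Rightarrow> complex \<Rightarrow> complex" where
  "power_bracket' k z = lfun z (A (J z ((A ^^ k) (wvec z)))) + lfun z ((A ^^ k) (J z (A (wvec z))))"

text \<open>The bracket of $AJA^kJA$, the auxiliary quantity that is eliminated in the end.\<close>

definition mid_bracket :: "nat \<Rightarrow> complex \<Rightarrow> complex" where
  "mid_bracket k z = lfun z (A (J z ((A ^^ k) (J z (A (wvec z))))))"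

lemma power_bracket_deriv: "z \<in> \<Omega> \<Longrightarrow> (power_bracket k has_field_derivative power_bracket' k z) (at z)"
  using lfun_smooth_deriv[OF smooth_A_pow[OF smooth_wvec]] by (simp add: power_bracket_def[abs_def] power_bracket'_def)

text \<open>These are the two words in the derivative of the bracket of $A^k$. In the second one,
  $JAJAw$ is simplified by lemma \<open>J_A_J\<close>, which doubles the multiple of \<open>w\<close>.\<close>

lemma smooth_words:
  shows "smooth (\<lambda>z. A (J z ((A ^^ k) (wvec z))))
      (\<lambda>z. A (J z ((A ^^ k) (J z (A (wvec z)))) - 2 *\<^sub>C (power_bracket k z *\<^sub>C wvec z)))"
    and "smooth (\<lambda>z. (A ^^ k) (J z (A (wvec z)))) (\<lambda>z. (A ^^ k) (A (A (wvec z)) - 4 *\<^sub>C (power_bracket 1 z *\<^sub>C wvec z)))"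
proof -
  show "smooth (\<lambda>z. A (J z ((A ^^ k) (wvec z))))
      (\<lambda>z. A (J z ((A ^^ k) (J z (A (wvec z)))) - 2 *\<^sub>C (power_bracket k z *\<^sub>C wvec z)))"
    unfolding power_bracket_def by (intro smooth_A smooth_J smooth_A_pow smooth_wvec)
  have "smooth (\<lambda>z. J z (A (wvec z))) (\<lambda>z. A (A (wvec z)) - 4 *\<^sub>C (power_bracket 1 z *\<^sub>C wvec z))"
  proof (rule smooth_cong[OF smooth_J[OF smooth_A[OF smooth_wvec]]])
    fix z assume z: "z \<in> \<Omega>"
    have "J z (A (J z (A (wvec z)))) - 2 *\<^sub>C (lfun z (A (wvec z)) *\<^sub>C wvec z) =
        A (A (wvec z)) - (2 *\<^sub>C (power_bracket 1 z *\<^sub>C wvec z) + 2 *\<^sub>C (power_bracket 1 z *\<^sub>C wvec z))"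
      using J_A_J[OF z A_in_Dinf[OF wvec_in_Dinf[OF z]]] by (simp add: power_bracket_def)
    then show "J z (A (J z (A (wvec z)))) - 2 *\<^sub>C (lfun z (A (wvec z)) *\<^sub>C wvec z) =
        A (A (wvec z)) - 4 *\<^sub>C (power_bracket 1 z *\<^sub>C wvec z)"
      by (simp flip: scaleC_add_left)
  qed
  then show "smooth (\<lambda>z. (A ^^ k) (J z (A (wvec z)))) (\<lambda>z. (A ^^ k) (A (A (wvec z)) - 4 *\<^sub>C (power_bracket 1 z *\<^sub>C wvec z)))"
    by (rule smooth_A_pow)
qed

lemma A_pow_2: "(A ^^ k) (A (A v)) = (A ^^ (k + 2)) v"
  by (simp add: funpow_swap1)

text \<open>Each of $AJA^kw$ and $A^kJAw$ contributes a mixed term $AJA^kJA$ and a term with adjacent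
  factors $JAJ$, which lemma \<open>J_A_J\<close> turns into $A^{k+2}$ and products of brackets.\<close>

lemma power_bracket'_deriv:
  assumes z: "z \<in> \<Omega>"
  shows "(power_bracket' k has_field_derivative 2 * power_bracket (k + 2) z - 8 * power_bracket 1 z * power_bracket k z + 2 * mid_bracket k z) (at z)"
proof -
  define u where "u = (A ^^ k) (wvec z)"
  define v where "v = (A ^^ k) (J z (A (wvec z)))"
  note linear = bounded_clinear_simps[OF lfun_clinear[OF z]]
  have wvec: "wvec z \<in> Dinf" by (rule wvec_in_Dinf[OF z])
  have u: "u \<in> Dinf" unfolding u_def by (intro A_pow_in_Dinf wvec)
  have v: "v \<in> Dinf" unfolding v_def by (intro A_pow_in_Dinf J_in_Dinf z A_in_Dinf wvec)
  have 1: "lfun z (A (J z (A (J z u)))) = power_bracket (k + 2) z - 2 * power_bracket k z * power_bracket 1 z"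
  proof -
    have "A (J z (A (J z u))) = A (A u) - 2 *\<^sub>C (lfun z u *\<^sub>C A (wvec z))"
      by (simp add: J_A_J z u wvec A_diff_Dinf A_scaleC_Dinf Dinf_intros)
    then show ?thesis by (simp add: linear) (simp add: power_bracket_def u_def)
  qed
  have 2: "lfun z (A (J z v - 2 *\<^sub>C (power_bracket k z *\<^sub>C wvec z))) = mid_bracket k z - 2 * power_bracket k z * power_bracket 1 z"
    by (simp add: A_diff_Dinf A_scaleC_Dinf Dinf_intros J_in_Dinf v wvec z linear)
       (simp add: mid_bracket_def v_def power_bracket_def)
  have 3: "lfun z ((A ^^ k) (A (A (wvec z)) - 4 *\<^sub>C (power_bracket 1 z *\<^sub>C wvec z))) = power_bracket (k + 2) z - 4 * power_bracket 1 z * power_bracket k z"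
    by (simp add: A_pow_diff A_pow_scaleC Dinf_intros wvec linear) (simp add: power_bracket_def A_pow_2)
  have "((\<lambda>y. lfun y (A (J y ((A ^^ k) (wvec y)))) + lfun y ((A ^^ k) (J y (A (wvec y))))) has_field_derivative
      (lfun z (A (J z (A (J z u)))) + lfun z (A (J z v - 2 *\<^sub>C (power_bracket k z *\<^sub>C wvec z)))) +
      (lfun z (A (J z v)) + lfun z ((A ^^ k) (A (A (wvec z)) - 4 *\<^sub>C (power_bracket 1 z *\<^sub>C wvec z))))) (at z)"
    unfolding u_def v_def by (intro DERIV_add lfun_smooth_deriv[OF _ z] smooth_words)
  moreover have "lfun z (A (J z v)) = mid_bracket k z" by (simp add: mid_bracket_def v_def)
  ultimately show ?thesis
    unfolding 1 2 3 power_bracket'_def[abs_def] by (simp add: algebra_simps)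
qed

text \<open>The outer factors \<open>J\<close> of $AJA^kJA$ are absorbed one at a time by lemma \<open>J_A_J\<close>; what
  remains are the two words that make up the derivative of the bracket of $A^{k+2}$, and multiples
  of the bracket of \<open>A\<close>.\<close>

lemma mid_bracket_deriv:
  assumes z: "z \<in> \<Omega>"
  shows "(mid_bracket k has_field_derivative power_bracket' (k + 2) z - 4 * power_bracket 1 z * power_bracket' k z) (at z)"
proof -
  define v where "v = (A ^^ k) (J z (A (wvec z)))"
  define v' where "v' = (A ^^ k) (A (A (wvec z)) - 4 *\<^sub>C (power_bracket 1 z *\<^sub>C wvec z))"
  note linear = bounded_clinear_simps[OF lfun_clinear[OF z]]
  have wvec: "wvec z \<in> Dinf" by (rule wvec_in_Dinf[OF z])
  have v: "v \<in> Dinf" unfolding v_def by (intro A_pow_in_Dinf J_in_Dinf z A_in_Dinf wvec)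
  have v': "v' \<in> Dinf" unfolding v'_def by (intro Dinf_intros wvec)
  have 1: "lfun z (A (J z (A (J z v)))) = lfun z ((A ^^ (k + 2)) (J z (A (wvec z)))) - 2 * lfun z v * power_bracket 1 z"
  proof -
    have "A (J z (A (J z v))) = A (A v) - 2 *\<^sub>C (lfun z v *\<^sub>C A (wvec z))"
      by (simp add: J_A_J z v wvec A_diff_Dinf A_scaleC_Dinf Dinf_intros)
    then show ?thesis by (simp add: linear) (simp add: power_bracket_def v_def)
  qed
  have 2: "lfun z (A (J z v')) = lfun z (A (J z ((A ^^ (k + 2)) (wvec z)))) - 4 * power_bracket 1 z * lfun z (A (J z ((A ^^ k) (wvec z))))"
  proof -
    have "v' = (A ^^ (k + 2)) (wvec z) - 4 *\<^sub>C (power_bracket 1 z *\<^sub>C (A ^^ k) (wvec z))"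
      unfolding v'_def by (simp add: A_pow_diff A_pow_scaleC Dinf_intros wvec A_pow_2 del: funpow.simps)
    then have "A (J z v') = A (J z ((A ^^ (k + 2)) (wvec z))) - 4 *\<^sub>C (power_bracket 1 z *\<^sub>C A (J z ((A ^^ k) (wvec z))))"
      by (simp add: bounded_clinear_simps[OF J_clinear[OF z]] A_diff_Dinf A_scaleC_Dinf
          J_in_Dinf Dinf_intros wvec z del: funpow.simps)
    then show ?thesis by (simp add: linear)
  qed
  have "smooth (\<lambda>z. A (J z ((A ^^ k) (J z (A (wvec z))))))
     (\<lambda>z. A (J z ((A ^^ k) (A (A (wvec z)) - 4 *\<^sub>C (power_bracket 1 z *\<^sub>C wvec z)))
        - 2 *\<^sub>C (lfun z ((A ^^ k) (J z (A (wvec z)))) *\<^sub>C wvec z)))"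
    by (intro smooth_A smooth_J smooth_words)
  from lfun_smooth_deriv[OF this z]
  have "(mid_bracket k has_field_derivative
      lfun z (A (J z (A (J z v)))) + lfun z (A (J z v' - 2 *\<^sub>C (lfun z v *\<^sub>C wvec z)))) (at z)"
    by (simp add: mid_bracket_def[abs_def] v_def v'_def)
  moreover have 3: "lfun z (A (J z v' - 2 *\<^sub>C (lfun z v *\<^sub>C wvec z))) = lfun z (A (J z v')) - 2 * lfun z v * power_bracket 1 z"
    by (simp add: A_diff_Dinf A_scaleC_Dinf Dinf_intros J_in_Dinf v' wvec z linear) (simp add: power_bracket_def)
  ultimately show ?thesis
    unfolding 3 2 1 by (simp add: power_bracket'_def v_def algebra_simps)
qed

text \<open>The formula for the second derivative contains one bracket that is not of a power of \<open>A\<close>;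
  differentiating once more and inserting lemma \<open>mid_bracket_deriv\<close> removes it.\<close>

lemma power_bracket_recursion:
  assumes z: "z \<in> \<Omega>"
  shows "4 * deriv (power_bracket (k + 2)) z =
    (deriv ^^ 3) (power_bracket k) z + 8 * deriv (power_bracket 1) z * power_bracket k z + 16 * power_bracket 1 z * deriv (power_bracket k) z"
proof -
  define g2 where "g2 z = 2 * power_bracket (k + 2) z - 8 * power_bracket 1 z * power_bracket k z + 2 * mid_bracket k z" for z
  have d1: "deriv (power_bracket j) y = power_bracket' j y" if "y \<in> \<Omega>" for j y
    by (rule DERIV_imp_deriv[OF power_bracket_deriv[OF that]])
  have d2: "deriv (deriv (power_bracket k)) y = g2 y" if y: "y \<in> \<Omega>" for y
    by (rule DERIV_imp_deriv, rule has_field_derivative_transform_within_open[OF _ domain(1) y])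
       (use power_bracket'_deriv[OF y] d1 in \<open>simp_all add: g2_def\<close>)
  have "(g2 has_field_derivative
      2 * power_bracket' (k + 2) z - (8 * (power_bracket' 1 z * power_bracket k z + power_bracket' k z * power_bracket 1 z)) + 2 * (power_bracket' (k + 2) z - 4 * power_bracket 1 z * power_bracket' k z)) (at z)"
    unfolding g2_def[abs_def] mult.assoc[of 8]
    by (intro DERIV_add DERIV_diff DERIV_cmult DERIV_mult power_bracket_deriv mid_bracket_deriv z)
  then have "(deriv (deriv (power_bracket k)) has_field_derivative
      2 * power_bracket' (k + 2) z - (8 * (power_bracket' 1 z * power_bracket k z + power_bracket' k z * power_bracket 1 z)) + 2 * (power_bracket' (k + 2) z - 4 * power_bracket 1 z * power_bracket' k z)) (at z)"
    by (rule has_field_derivative_transform_within_open[OF _ domain(1) z]) (simp add: d2)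
  from DERIV_imp_deriv[OF this] show ?thesis
    by (simp add: d1[OF z] numeral_3_eq_3 algebra_simps)
qed

lemma bracket_power: "bracket A B C E (\<lambda>x. A ^^ k) = power_bracket k"
proof -
  have "(\<lambda>x. A ^^ k) \<in> alg_Sigma A (sys_F E B C)"
    by (intro alg_Sigma.word words.power)
  then show ?thesis
    by (simp add: bracket_def power_bracket_def lfun_def wvec_def F_def fun_eq_iff)
qed

lemma wvec_in_pow_dom: "z \<in> \<Omega> \<Longrightarrow> sys_F E B C z (E z (B 1)) \<in> pow_dom D A k"
  using wvec_in_Dinf[of z] by (simp add: pow_dom_def Dinf_def wvec_def F_def)

lemma power_bracket_holomorphic: "power_bracket k holomorphic_on \<Omega>"
  unfolding holomorphic_on_def field_differentiable_def
  using power_bracket_deriv has_field_derivative_at_within by blast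

end

theorem proposition5p1:
  fixes A :: "'h::{complex_hilbert,second_countable_topology} \<Rightarrow> 'h"
    and D :: "'h set"
    and T :: "real \<Rightarrow> 'h \<Rightarrow> 'h"
    and B :: "complex \<Rightarrow> 'h"
    and C :: "'h \<Rightarrow> complex"
    and E :: "complex \<Rightarrow> 'h \<Rightarrow> 'h"
    and t0 \<theta> a \<phi> :: real
    and \<Omega> :: "complex set"
    and br :: "nat \<Rightarrow> complex \<Rightarrow> complex"
    and f :: "nat \<Rightarrow> complex \<Rightarrow> complex"
  assumes system: "linear_system D A T B C"
    and admissible: "admissible22 T B C"
    and decay: "t0 > 0" "onorm (T t0) < 1"
    and HS: "hilbert_schmidt B" "hilbert_schmidt C" "hs_norm B * hs_norm C \<le> 1"
    and sectorial: "pi / 2 < \<theta>" "\<theta> < pi" "sectorial_on D (\<lambda>v. - A v) \<theta>"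
    and Omega: "0 < \<phi>" "\<phi> < pi" "\<Omega> = {x. x - complex_of_real a \<in> sector \<phi>}"
    and holomorphic: "holomorphic_system_on T B C E \<Omega>"
    and br_def: "\<And>k. br k = bracket A B C E (\<lambda>x. A ^^ k)"
    and f_def: "\<And>m x. f m x = (- 1) ^ m * 2 * br (2 * m - 1) x"
  shows "(\<forall>k. \<forall>x\<in>\<Omega>. sys_F E B C x (E x (B 1)) \<in> pow_dom D A k)
       \<and> (\<forall>k. br k holomorphic_on \<Omega>)
       \<and> (\<forall>m\<ge>1. \<forall>x\<in>\<Omega>.
            4 * deriv (f (m + 1)) x =
              4 * f 1 x * deriv (f m) x + 4 * deriv (\<lambda>y. f 1 y * f m y) x - (deriv ^^ 3) (f m) x)
       \<and> (\<forall>m. \<forall>x\<in>\<Omega>.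
            4 * deriv (br (2 * m + 3)) x =
              (deriv ^^ 3) (br (2 * m + 1)) x + 8 * deriv (br 1) x * br (2 * m + 1) x
                + 16 * br 1 x * deriv (br (2 * m + 1)) x)"
proof -
  note \<Omega> = shifted_sector_properties[OF Omega]
  interpret continued_system A D T B C E t0 a \<Omega>
    by unfold_locales (use system decay holomorphic \<Omega> in auto)
  have br: "br k = power_bracket k" for k
    by (simp add: br_def bracket_power)
  have hol: "br k holomorphic_on \<Omega>" for k
    by (simp add: br power_bracket_holomorphic)
  have rec: "4 * deriv (br (k + 2)) x =
      (deriv ^^ 3) (br k) x + 8 * deriv (br 1) x * br k x + 16 * br 1 x * deriv (br k) x"
    if "x \<in> \<Omega>" for k x
    unfolding br by (rule power_bracket_recursion[OF that])
  have KdV: "4 * deriv (f (m + 1)) x =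
      4 * f 1 x * deriv (f m) x + 4 * deriv (\<lambda>y. f 1 y * f m y) x - (deriv ^^ 3) (f m) x"
    if m: "m \<ge> 1" and x: "x \<in> \<Omega>" for m x
  proof -
    define c where "c = (- 1) ^ m * (2 :: complex)"
    define h where "h = br (2 * m - 1)"
    have hol': "h holomorphic_on \<Omega>" unfolding h_def by (rule hol)
    have fm: "f m = (\<lambda>y. c * h y)" by (simp add: fun_eq_iff f_def c_def h_def)
    have f1: "f 1 = (\<lambda>y. - 2 * br 1 y)" by (simp add: fun_eq_iff f_def)
    have "2 * (m + 1) - 1 = (2 * m - 1) + 2" using m by simp
    then have fm1: "f (m + 1) = (\<lambda>y. - c * br ((2 * m - 1) + 2) y)"
      unfolding fun_eq_iff f_def by (simp add: c_def)
    note diff = holomorphic_on_imp_differentiable_at[OF _ \<Omega>(1) x]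
    have d3: "(deriv ^^ 3) (f m) x = c * (deriv ^^ 3) h x"
      unfolding fm by (rule higher_deriv_cmult[OF hol' x \<Omega>(1)])
    have d1: "deriv (f m) x = c * deriv h x"
      unfolding fm by (rule deriv_cmult[OF diff[OF hol']])
    have d1': "deriv (f 1) x = - 2 * deriv (br 1) x"
      unfolding f1 by (rule deriv_cmult[OF diff[OF hol]])
    have prod: "deriv (\<lambda>y. f 1 y * f m y) x = f 1 x * deriv (f m) x + deriv (f 1) x * f m x"
    proof (rule deriv_mult)
      show "f 1 field_differentiable at x"
        by (rule diff) (unfold f1, intro holomorphic_intros hol)
      show "f m field_differentiable at x"
        by (rule diff) (unfold fm, intro holomorphic_intros hol')
    qed
    have "4 * deriv (f (m + 1)) x = - c * (4 * deriv (br ((2 * m - 1) + 2)) x)"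
      unfolding fm1 by (subst deriv_cmult[OF diff[OF hol]]) simp
    also have "\<dots> = - c * ((deriv ^^ 3) h x + 8 * deriv (br 1) x * h x + 16 * br 1 x * deriv h x)"
      by (simp only: rec[OF x] h_def)
    also have "\<dots> = 4 * f 1 x * deriv (f m) x + 4 * deriv (\<lambda>y. f 1 y * f m y) x - (deriv ^^ 3) (f m) x"
      unfolding prod unfolding d1 d1' d3 unfolding fun_cong[OF f1] fun_cong[OF fm]
      by (simp add: algebra_simps)
    finally show ?thesis .
  qed
  show ?thesis
  proof (intro conjI allI impI ballI)
    show "sys_F E B C x (E x (B 1)) \<in> pow_dom D A k" if "x \<in> \<Omega>" for k x
      by (rule wvec_in_pow_dom[OF that])
    show "4 * deriv (br (2 * m + 3)) x =
        (deriv ^^ 3) (br (2 * m + 1)) x + 8 * deriv (br 1) x * br (2 * m + 1) x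
          + 16 * br 1 x * deriv (br (2 * m + 1)) x" if "x \<in> \<Omega>" for m x
    proof -
      have "2 * m + 3 = (2 * m + 1) + 2" by simp
      then show ?thesis by (simp only: rec[OF that])
    qed
  qed (use hol KdV in auto)
qed

end
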